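(* $\omega^2\cdot 3\leq R^{top}(\omega\cdot 2,3)\leq\omega^3\cdot 100$.
   Context: All arithmetic operations on ordinals are in the ordinal sense. Every ordinal is identified with the set of smaller ordinals and carries the order topology; subsets carry the subspace topology. $[X]^2$ is the set of $2$-element subsets of $X$. $R^{top}(\alpha,k)$ is the least ordinal $\beta$ such that for every coloring $c:[\beta]^2\to\{\text{red},\text{blue}\}$ either there is a subspace $X\subseteq\beta$ homeomorphic to $\alpha$ with all elements of $[X]^2$ red, or there is a $k$-element $Y\subseteq\beta$ with all elements of $[Y]^2$ blue. *)

theory Defs
  imports "HOL-Analysis.Analysis" "HOL-Library.Ramsey"
begin

unbundle cardinal_syntax

text \<open>
  As in the theories on well-orders in Main, an ordinal is represented by a well-order relation
  on an arbitrary type, up to \<open>ordIso\<close>; the ordinals are compared by \<open>\<le>o\<close>, and the set of ordinals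
  below the one represented by \<open>r\<close> is represented by \<open>Field r\<close>. In particular \<open>natLeq\<close> is
  \<open>\<omega>\<close> and \<open>natLeq_on n\<close> is the finite ordinal \<open>n\<close>.
\<close>

text \<open>
  The ordinal product \<open>r \<cdot> s\<close>, that is \<open>s\<close> consecutive copies of \<open>r\<close>: the second component
  is the significant one. Finite powers are iterated products, \<open>\<alpha>\<^sup>n\<^sup>+\<^sup>1 = \<alpha>\<^sup>n \<cdot> \<alpha>\<close>, since the type
  of the relation grows with the exponent.
\<close>

definition ord_prod :: "'a rel \<Rightarrow> 'b rel \<Rightarrow> ('a \<times> 'b) rel"  (infixl \<open>\<cdot>\<^sub>o\<close> 70)
  where "r \<cdot>\<^sub>o s = {((x, y), (x', y')). x \<in> Field r \<and> x' \<in> Field r \<and>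
           ((y, y') \<in> s \<and> y \<noteq> y' \<or> y = y' \<and> y \<in> Field s \<and> (x, x') \<in> r)}"

text \<open>
  \<open>Field r\<close> is added to the subbasis of open rays because the rays do not cover a one-point
  order.
\<close>

definition ord_topology :: "'a rel \<Rightarrow> 'a topology"
  where "ord_topology r =
    topology_generated_by (insert (Field r) (underS r ` Field r \<union> aboveS r ` Field r))"

datatype colour = Red | Blue

text \<open>
  The partition relation in the definition of the topological Ramsey numbers. Only the values of
  \<open>c\<close> on two-element subsets of \<open>Field \<beta>\<close> matter.
\<close>

definition top_arrow :: "'b rel \<Rightarrow> 'a rel \<Rightarrow> nat \<Rightarrow> bool"
  where "top_arrow \<beta> \<alpha> k \<longleftrightarrow>
    (\<forall>c :: 'b set \<Rightarrow> colour.
       (\<exists>X \<subseteq> Field \<beta>. subtopology (ord_topology \<beta>) X homeomorphic_space ord_topology \<alpha> \<and>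
                     (\<forall>e \<in> nsets X 2. c e = Red)) \<or>
       (\<exists>Y \<in> nsets (Field \<beta>) k. \<forall>e \<in> nsets Y 2. c e = Blue))"

text \<open>
  \<open>\<beta>\<close> represents \<open>R\<^sup>t\<^sup>o\<^sup>p(\<alpha>, k)\<close>. Letting \<open>\<gamma>\<close> range over well-orders on the type of \<open>\<beta>\<close>
  suffices for leastness among all ordinals, because every ordinal below \<open>\<beta>\<close> is represented
  by an initial segment of \<open>\<beta>\<close>; see \<open>is_top_ramsey_least\<close> below.
\<close>

definition is_top_ramsey :: "'b rel \<Rightarrow> 'a rel \<Rightarrow> nat \<Rightarrow> bool"
  where "is_top_ramsey \<beta> \<alpha> k \<longleftrightarrow>
    Well_order \<beta> \<and> top_arrow \<beta> \<alpha> k \<and>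
    (\<forall>\<gamma> :: 'b rel. Well_order \<gamma> \<and> top_arrow \<gamma> \<alpha> k \<longrightarrow> \<beta> \<le>o \<gamma>)"

lemma topspace_ord_topology [simp]: "topspace (ord_topology r) = Field r"
proof -
  have "underS r a \<subseteq> Field r" "aboveS r a \<subseteq> Field r" for a
    by (auto simp: underS_def aboveS_def Field_def)
  then show ?thesis
    by (auto simp: ord_topology_def)
qed

lemma Field_ord_prod: "Field (r \<cdot>\<^sub>o s) = Field r \<times> Field s"
proof
  show "Field (r \<cdot>\<^sub>o s) \<subseteq> Field r \<times> Field s"
    by (auto simp: ord_prod_def Field_def)
  show "Field r \<times> Field s \<subseteq> Field (r \<cdot>\<^sub>o s)"
  proof clarify
    fix x y assume "x \<in> Field r" "y \<in> Field s"
    moreover from this obtain x' where "x' \<in> Field r" "(x, x') \<in> r \<or> (x', x) \<in> r"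
      by (auto simp: Field_def)
    ultimately have "((x, y), (x', y)) \<in> r \<cdot>\<^sub>o s \<or> ((x', y), (x, y)) \<in> r \<cdot>\<^sub>o s"
      by (auto simp: ord_prod_def)
    then show "(x, y) \<in> Field (r \<cdot>\<^sub>o s)"
      by (auto simp: Field_def)
  qed
qed

lemma Well_order_ord_prod:
  assumes r: "Well_order r" and s: "Well_order s"
  shows "Well_order (r \<cdot>\<^sub>o s)"
proof -
  have R: "Refl r" "trans r" "antisym r" "Total r" "wf (r - Id)"
    using r by (auto simp: order_on_defs)
  have S: "Refl s" "trans s" "antisym s" "Total s" "wf (s - Id)"
    using s by (auto simp: order_on_defs)
  have "Refl (r \<cdot>\<^sub>o s)"
    unfolding refl_on_def Field_ord_prod using R(1) by (auto simp: ord_prod_def refl_on_def)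
  moreover have "trans (r \<cdot>\<^sub>o s)"
    unfolding trans_def ord_prod_def using R(2) S(2,3)
    by clarsimp (metis antisymD transD)
  moreover have "antisym (r \<cdot>\<^sub>o s)"
    unfolding antisym_def ord_prod_def using R(3) S(3)
    by clarsimp (metis antisymD)
  moreover have "Total (r \<cdot>\<^sub>o s)"
    unfolding total_on_def Field_ord_prod using R(1,4) S(4)
    by (auto simp: ord_prod_def total_on_def)
  moreover have "wf (r \<cdot>\<^sub>o s - Id)"
  proof -
    have "wf (inv_image ((s - Id) <*lex*> (r - Id)) prod.swap)"
      using R(5) S(5) by (intro wf_inv_image wf_lex_prod)
    then show ?thesis
      by (rule wf_subset) (auto simp: ord_prod_def)
  qed
  moreover have "r \<cdot>\<^sub>o s \<subseteq> Field (r \<cdot>\<^sub>o s) \<times> Field (r \<cdot>\<^sub>o s)"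
    by (auto simp: Field_def)
  ultimately show ?thesis
    by (simp add: order_on_defs)
qed

lemma iso_homeomorphic_map:
  assumes "Well_order r" "iso r s f"
  shows "homeomorphic_map (ord_topology r) (ord_topology s) f"
proof -
  have 1: "continuous_map (ord_topology r) (ord_topology s) f"
    if bij: "bij_betw f (Field r) (Field s)"
      and f: "\<forall>a\<in>Field r. \<forall>b\<in>Field r. (a, b) \<in> r \<longleftrightarrow> (f a, f b) \<in> s"
    for r :: "'x rel" and s :: "'y rel" and f
  proof -
    have "openin (ord_topology r) (f -` U \<inter> Field r)"
      if "U \<in> insert (Field s) (underS s ` Field s \<union> aboveS s ` Field s)" for U
    proof -
      have sur: "\<exists>b\<in>Field r. y = f b" if "y \<in> Field s" for y
        using bij that by (auto simp: bij_betw_def)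
      from that consider "U = Field s"
        | b where "b \<in> Field r" "U = underS s (f b)" | b where "b \<in> Field r" "U = aboveS s (f b)"
        by (auto dest: sur)
      then have "f -` U \<inter> Field r \<in> insert (Field r) (underS r ` Field r \<union> aboveS r ` Field r)"
      proof cases
        case 1
        then have "f -` U \<inter> Field r = Field r"
          using bij by (auto simp: bij_betw_def)
        then show ?thesis by simp
      next
        case 2
        have "x \<in> f -` U \<inter> Field r \<longleftrightarrow> x \<in> underS r b" for x
        proof (cases "x \<in> Field r")
          case True
          then have "f x = f b \<longleftrightarrow> x = b"
            using bij \<open>b \<in> Field r\<close> by (auto simp: bij_betw_def inj_on_def)
          then show ?thesis
            using True f \<open>b \<in> Field r\<close> \<open>U = underS s (f b)\<close> by (simp add: underS_def)
        next
          case False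
          then show ?thesis
            by (auto simp: underS_def Field_def)
        qed
        then have "f -` U \<inter> Field r = underS r b" by blast
        with 2 show ?thesis by auto
      next
        case 3
        have "x \<in> f -` U \<inter> Field r \<longleftrightarrow> x \<in> aboveS r b" for x
        proof (cases "x \<in> Field r")
          case True
          then have "f x = f b \<longleftrightarrow> x = b"
            using bij \<open>b \<in> Field r\<close> by (auto simp: bij_betw_def inj_on_def)
          then show ?thesis
            using True f \<open>b \<in> Field r\<close> \<open>U = aboveS s (f b)\<close> by (simp add: aboveS_def)
        next
          case False
          then show ?thesis
            by (auto simp: aboveS_def Field_def)
        qed
        then have "f -` U \<inter> Field r = aboveS r b" by blast
        with 3 show ?thesis by auto
      qed
      then show ?thesis
        unfolding ord_topology_def by (rule topology_generated_by_Basis)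
    qed
    moreover have "f ` Field r \<subseteq> \<Union> (insert (Field s) (underS s ` Field s \<union> aboveS s ` Field s))"
      using bij by (auto simp: bij_betw_def)
    ultimately show ?thesis
      unfolding ord_topology_def[of s]
      by (intro continuous_on_generated_topo) auto
  qed
  have bij: "bij_betw f (Field r) (Field s)"
    and f: "\<forall>a\<in>Field r. \<forall>b\<in>Field r. (a, b) \<in> r \<longleftrightarrow> (f a, f b) \<in> s"
    using assms(2) unfolding iso_iff2 by auto
  define g where "g = the_inv_into (Field r) f"
  have g: "bij_betw g (Field s) (Field r)"
    unfolding g_def by (rule bij_betw_the_inv_into[OF bij])
  have gf: "g (f x) = x" if "x \<in> Field r" for x
    using bij that by (auto simp: g_def bij_betw_def the_inv_into_f_f)
  have fg: "f (g y) = y" if "y \<in> Field s" for y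
    using bij that by (auto simp: g_def bij_betw_def f_the_inv_into_f)
  have g': "\<forall>a\<in>Field s. \<forall>b\<in>Field s. (a, b) \<in> s \<longleftrightarrow> (g a, g b) \<in> r"
    using f fg g by (metis bij_betwE)
  have "homeomorphic_maps (ord_topology r) (ord_topology s) f g"
    unfolding homeomorphic_maps_def using 1[OF bij f] 1[OF g g'] gf fg by auto
  then show ?thesis
    by (simp add: homeomorphic_map_maps) blast
qed

lemma top_arrow_ordIso:
  assumes "(r, s) \<in> ordIso" and "top_arrow r \<alpha> k"
  shows "top_arrow s \<alpha> k"
  unfolding top_arrow_def
proof
  fix c :: "'b set \<Rightarrow> colour"
  from assms(1) obtain f where r: "Well_order r" and iso: "iso r s f"
    by (auto simp: ordIso_def)
  have bij: "bij_betw f (Field r) (Field s)"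
    using iso unfolding iso_iff2 by auto
  have hom: "homeomorphic_map (ord_topology r) (ord_topology s) f"
    by (rule iso_homeomorphic_map[OF r iso])
  have pairs: "\<exists>e'\<in>nsets X 2. e = f ` e'" if "X \<subseteq> Field r" "e \<in> nsets (f ` X) 2" for X e
  proof -
    from that(2) obtain e' where e': "e' \<subseteq> X" "e = f ` e'"
      by (auto simp: nsets_def subset_image_iff)
    have "inj_on f e'"
      using bij e'(1) that(1) by (auto simp: bij_betw_def intro: inj_on_subset)
    then show ?thesis
      using e' that(2) by (auto simp: nsets_def card_image finite_image_iff)
  qed
  consider X where "X \<subseteq> Field r" "subtopology (ord_topology r) X homeomorphic_space ord_topology \<alpha>"
        "\<forall>e \<in> nsets X 2. c (f ` e) = Red"
    | Y where "Y \<in> nsets (Field r) k" "\<forall>e \<in> nsets Y 2. c (f ` e) = Blue"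
    using assms(2)[unfolded top_arrow_def, rule_format, of "\<lambda>e. c (f ` e)"] by blast
  then show "(\<exists>X\<subseteq>Field s. subtopology (ord_topology s) X homeomorphic_space ord_topology \<alpha> \<and>
               (\<forall>e\<in>nsets X 2. c e = Red)) \<or>
             (\<exists>Y\<in>nsets (Field s) k. \<forall>e\<in>nsets Y 2. c e = Blue)"
  proof cases
    case 1
    have "homeomorphic_map (subtopology (ord_topology r) X) (subtopology (ord_topology s) (f ` X)) f"
      using 1(1) bij hom by (intro homeomorphic_map_subtopologies) (auto simp: bij_betw_def)
    then have "subtopology (ord_topology s) (f ` X) homeomorphic_space ord_topology \<alpha>"
      using 1(2) homeomorphic_map_imp_homeomorphic_space homeomorphic_space_sym
        homeomorphic_space_trans by blast
    moreover have "f ` X \<subseteq> Field s"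
      using 1(1) bij by (auto simp: bij_betw_def)
    moreover have "\<forall>e\<in>nsets (f ` X) 2. c e = Red"
      using 1(3) pairs[OF 1(1)] by blast
    ultimately show ?thesis by blast
  next
    case 2
    then have Y: "Y \<subseteq> Field r" by (auto simp: nsets_def)
    then have "inj_on f Y"
      using bij by (auto simp: bij_betw_def intro: inj_on_subset)
    then have "f ` Y \<in> nsets (Field s) k"
      using 2(1) bij by (auto simp: nsets_def card_image bij_betw_def)
    moreover have "\<forall>e\<in>nsets (f ` Y) 2. c e = Blue"
      using 2(2) pairs[OF Y] by blast
    ultimately show ?thesis by blast
  qed
qed

lemma is_top_ramsey_least:
  fixes \<beta> :: "'b rel" and \<gamma> :: "'c rel"
  assumes \<beta>: "is_top_ramsey \<beta> \<alpha> k" and \<gamma>: "Well_order \<gamma>" "top_arrow \<gamma> \<alpha> k"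
  shows "\<beta> \<le>o \<gamma>"
proof (rule ccontr)
  assume "\<not> \<beta> \<le>o \<gamma>"
  moreover have wo: "Well_order \<beta>"
    using \<beta> by (simp add: is_top_ramsey_def)
  ultimately have less: "\<gamma> <o \<beta>"
    using \<gamma>(1) by (simp add: not_ordLeq_iff_ordLess)
  then obtain a where a: "(\<gamma>, Restr \<beta> (underS \<beta> a)) \<in> ordIso"
    using \<gamma>(1) wo by (auto simp: ordLess_iff_ordIso_Restr)
  have "top_arrow (Restr \<beta> (underS \<beta> a)) \<alpha> k"
    by (rule top_arrow_ordIso[OF a \<gamma>(2)])
  then have "\<beta> \<le>o Restr \<beta> (underS \<beta> a)"
    using \<beta> wo by (simp add: is_top_ramsey_def Well_order_Restr)
  then have "\<beta> \<le>o \<gamma>"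
    using a by (meson ordIso_symmetric ordLeq_ordIso_trans)
  with less show False
    by (simp add: not_ordLess_ordLeq)
qed

end

theory Submission
  imports Defs
begin

text \<open>
  Call \<open>x\<close> and \<open>y\<close> adjacent when the pair \<open>{x, y}\<close> is blue. A colouring without a blue triple is a
  triangle-free graph, and in it the neighbourhood of every point is red. As a space,
  \<open>\<omega> \<cdot> 2\<close> is a convergent sequence with its limit together with an infinite closed discrete set. So
  in a Hausdorff space one finds a copy of it from two sequences with different limits by keeping
  only one of the limits (\<open>two_convergent_sequences_homeomorphic\<close>).

  Lower bound. Let every successor ordinal be adjacent to the next limit ordinal and to all
  multiples of \<open>\<omega>\<^sup>2\<close>, and let every limit ordinal strictly between \<open>0\<close> and \<open>\<omega>\<^sup>2\<close> be adjacent to every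
  limit ordinal strictly between \<open>\<omega>\<^sup>2\<close> and \<open>\<omega>\<^sup>2 \<cdot> 2\<close>. There is no triangle. In a red copy of
  \<open>\<omega> \<cdot> 2\<close> the limit point must be \<open>\<omega>\<^sup>2\<close> or \<open>\<omega>\<^sup>2 \<cdot> 2\<close>, and then the copy consists of multiples of \<open>\<omega>\<close>.
  Below an ordinal smaller than \<open>\<omega>\<^sup>2 \<cdot> 3\<close> only finitely many of these are above \<open>\<omega>\<^sup>2 \<cdot> 2\<close>, so the
  copy meets both of the intervals between which everything is blue.

  Upper bound. Already \<open>\<omega>\<^sup>3\<close> has the partition property, because it contains infinitely many
  points \<open>p\<^sub>i\<close> of rank two: \<open>p\<^sub>i\<close> is the limit of points \<open>q\<^sub>i\<^sub>j\<close>, and \<open>q\<^sub>i\<^sub>j\<close> is the limit of points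
  \<open>w\<^sub>i\<^sub>j\<^sub>k\<close>. A free ultrafilter \<open>\<U>\<close> on the natural numbers induces ultrafilters \<open>W\<^sub>i\<^sub>j\<close> on the
  points \<open>w\<^sub>i\<^sub>j\<^sub>k\<close>, converging to \<open>q\<^sub>i\<^sub>j\<close>, and \<open>U\<^sub>i\<close> and \<open>V\<^sub>i\<close> on the points \<open>q\<^sub>i\<^sub>j\<close> and \<open>w\<^sub>i\<^sub>j\<^sub>k\<close>,
  converging to \<open>p\<^sub>i\<close>. Say that a point is near an ultrafilter when it is adjacent to almost all points,
  and that there is an arrow from \<open>F\<close> to \<open>G\<close> when almost all points of \<open>F\<close> are near \<open>G\<close>. These arrows
  form no transitive triangle, and there are none between two ultrafilters near the same
  point. If \<open>F\<close> converges to \<open>p\<close> and \<open>G\<close> to another point, \<open>p\<close> is near neither, and there is no arrow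
  between them, then generic choices from \<open>F\<close> and \<open>G\<close> yield a red copy of \<open>\<omega> \<cdot> 2\<close> with limit point
  \<open>p\<close> (\<open>red_copy_of_omega_times_2\<close>).

  Assume that there is no red copy. Then no point is near both \<open>U\<^sub>i\<close> and \<open>V\<^sub>i\<close>. And if
  \<open>X\<^sub>i\<close> converges to \<open>p\<^sub>i\<close> and infinitely many \<open>p\<^sub>i\<close> are not near their own \<open>X\<^sub>i\<close>, then
  infinitely many of these are near \<open>X\<^sub>j\<close> for all other \<open>j\<close> (\<open>cross_adjacency\<close>, a use of
  Ramsey's theorem). The lemma \<open>no_rank_two_points\<close> plays these two facts against each other, for
  \<open>X = U\<close> and \<open>X = V\<close>.
\<close>

section \<open>Free ultrafilters\<close>

text \<open>
  Freeness is part of the definition since only nonprincipal ultrafilters describe the tail of a sequence.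
\<close>

definition free_ultrafilter :: "'a filter \<Rightarrow> bool"
  where "free_ultrafilter F \<longleftrightarrow> F \<noteq> bot \<and> (\<forall>P. eventually P F \<or> eventually (\<lambda>x. \<not> P x) F) \<and>
    (\<forall>a. eventually (\<lambda>x. x \<noteq> a) F)"

lemma free_ultrafilter_not_bot: "free_ultrafilter F \<Longrightarrow> F \<noteq> bot"
  by (simp add: free_ultrafilter_def)

lemma free_ultrafilter_neq: "free_ultrafilter F \<Longrightarrow> eventually (\<lambda>x. x \<noteq> a) F" "free_ultrafilter F \<Longrightarrow> eventually (\<lambda>x. a \<noteq> x) F"
  by (auto simp: free_ultrafilter_def elim: eventually_mono)

lemma free_ultrafilter_eventually_not:
  assumes "free_ultrafilter F"
  shows "eventually (\<lambda>x. \<not> P x) F \<longleftrightarrow> \<not> eventually P F"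
proof -
  have "\<not> (eventually P F \<and> eventually (\<lambda>x. \<not> P x) F)"
    using eventually_conj[of P F "\<lambda>x. \<not> P x"] assms by (auto simp: free_ultrafilter_def)
  then show ?thesis
    using assms by (auto simp: free_ultrafilter_def)
qed

text \<open>
  An ultrafilter is a minimal proper filter, so Zorn's lemma applies to the proper filters below
  \<open>sequentially\<close> under reverse inclusion; the infimum of a chain of proper filters is proper because the
  chain is a filter base.
\<close>

lemma exists_free_ultrafilter_nat: "\<exists>F :: nat filter. free_ultrafilter F"
proof -
  define A where "A = {F :: nat filter. F \<noteq> bot \<and> F \<le> sequentially}"
  have "\<exists>m \<in> A. \<forall>a \<in> A. m \<ge> a \<longrightarrow> a = m"
  proof (rule predicate_Zorn)
    show "partial_order_on A (relation_of (\<ge>) A)"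
      by (rule partial_order_on_relation_ofI) auto
    fix C assume C: "C \<in> Chains (relation_of (\<ge>) A)"
    then have CA: "C \<subseteq> A" and tot: "\<And>F G. F \<in> C \<Longrightarrow> G \<in> C \<Longrightarrow> F \<le> G \<or> G \<le> F"
      by (auto simp: Chains_def relation_of_def)
    show "\<exists>u\<in>A. \<forall>a\<in>C. a \<ge> u"
    proof (cases "C = {}")
      case True
      then show ?thesis
        by (intro bexI[of _ sequentially]) (auto simp: A_def)
    next
      case False
      have "eventually P (Inf C) \<longleftrightarrow> (\<exists>b\<in>C. eventually P b)" for P
        using tot by (intro eventually_Inf_base False) (metis inf.absorb1 inf.absorb2 order_refl)
      then have "Inf C \<noteq> bot"
        using CA by (auto simp: trivial_limit_def A_def)
      moreover have "Inf C \<le> sequentially"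
        using False CA by (auto simp: A_def intro: Inf_lower2)
      ultimately show ?thesis
        by (intro bexI[of _ "Inf C"]) (auto simp: A_def intro: Inf_lower)
    qed
  qed
  then obtain m where m: "m \<noteq> bot" "m \<le> sequentially" and min: "\<And>F. F \<in> A \<Longrightarrow> F \<le> m \<Longrightarrow> F = m"
    by (auto simp: A_def)
  have "eventually P m" if "\<not> eventually (\<lambda>x. \<not> P x) m" for P
  proof -
    \<comment> \<open>Adding the set of all \<open>x\<close> with \<open>P x\<close> to \<open>m\<close> keeps it proper, hence by minimality changes nothing.\<close>
    have "inf m (principal {x. P x}) \<noteq> bot"
      using that by (simp add: trivial_limit_def eventually_inf_principal)
    then have "inf m (principal {x. P x}) = m"
      using m(2) by (intro min) (auto simp: A_def intro: le_infI1)
    then have "m \<le> principal {x. P x}"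
      by (metis inf.cobounded2)
    then show ?thesis
      by (simp add: le_principal)
  qed
  moreover have "eventually (\<lambda>x. x \<noteq> a) m" for a
  proof (rule filter_leD[OF m(2)])
    show "eventually (\<lambda>x. x \<noteq> a) sequentially"
      using eventually_gt_at_top[of a] by (rule eventually_mono) auto
  qed
  ultimately show ?thesis
    using m(1) by (auto simp: free_ultrafilter_def)
qed

lemma free_ultrafilter_le_sequentially:
  assumes "free_ultrafilter F"
  shows "F \<le> sequentially"
proof (rule filter_leI)
  fix P assume "eventually P sequentially"
  then obtain N :: nat where N: "\<And>n. n \<ge> N \<Longrightarrow> P n"
    by (auto simp: eventually_sequentially)
  have "eventually (\<lambda>x. \<forall>a\<in>{..<N}. x \<noteq> a) F"
    using assms by (intro eventually_ball_finite) (auto simp: free_ultrafilter_def)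
  then show "eventually P F"
    by (rule eventually_mono) (use N leI in blast)
qed

lemma free_ultrafilter_filtermap:
  assumes "free_ultrafilter F" "inj f"
  shows "free_ultrafilter (filtermap f F)"
proof -
  have "eventually (\<lambda>x. f x \<noteq> a) F" for a
  proof (cases "a \<in> range f")
    case True
    then obtain b where "a = f b" by auto
    then show ?thesis
      using assms by (simp add: inj_eq free_ultrafilter_neq)
  qed (auto intro: always_eventually)
  then show ?thesis
    using assms by (auto simp: free_ultrafilter_def eventually_filtermap filtermap_bot_iff)
qed

text \<open>
  The Fubini sum of the filters \<open>G i\<close> along \<open>F\<close>.
\<close>

definition iterated_limit :: "'i filter \<Rightarrow> ('i \<Rightarrow> 'a filter) \<Rightarrow> 'a filter"
  where "iterated_limit F G = Abs_filter (\<lambda>P. eventually (\<lambda>i. eventually P (G i)) F)"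

lemma eventually_iterated_limit:
  "eventually P (iterated_limit F G) \<longleftrightarrow> eventually (\<lambda>i. eventually P (G i)) F"
  unfolding iterated_limit_def
proof (rule eventually_Abs_filter, rule is_filter.intro)
  show "eventually (\<lambda>i. eventually (\<lambda>x. P x \<and> Q x) (G i)) F"
    if "eventually (\<lambda>i. eventually P (G i)) F" "eventually (\<lambda>i. eventually Q (G i)) F" for P Q
    using that by (simp add: eventually_conj_iff)
  show "eventually (\<lambda>i. eventually Q (G i)) F"
    if "\<forall>x. P x \<longrightarrow> Q x" "eventually (\<lambda>i. eventually P (G i)) F" for P Q
    using that(2) by (rule eventually_mono) (use that(1) in \<open>auto elim: eventually_mono\<close>)
qed simp

lemma free_ultrafilter_iterated_limit:
  assumes F: "free_ultrafilter F" and G: "\<And>i. free_ultrafilter (G i)"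
  shows "free_ultrafilter (iterated_limit F G)"
proof -
  have "iterated_limit F G \<noteq> bot"
    using F G by (simp add: trivial_limit_def eventually_iterated_limit free_ultrafilter_def)
  moreover have "eventually P (iterated_limit F G) \<or> eventually (\<lambda>x. \<not> P x) (iterated_limit F G)" for P
    using assms by (auto simp: eventually_iterated_limit free_ultrafilter_eventually_not)
  moreover have "eventually (\<lambda>x. x \<noteq> a) (iterated_limit F G)" for a
    using G by (simp add: eventually_iterated_limit free_ultrafilter_neq)
  ultimately show ?thesis
    by (auto simp: free_ultrafilter_def)
qed

section \<open>Generic convergent sequences\<close>

text \<open>
  Every new member is picked among those points that are related to almost all points of each of the
  filters. Finitely many requirements are met by almost all points, so the choice never gets stuck; that
  only finitely many filters occur makes being good for all of them a finite requirement.
\<close>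

lemma generic_sequence:
  fixes H :: "nat \<Rightarrow> 'a filter"
  assumes nonbot: "\<And>n. H n \<noteq> bot" and fin: "finite (range H)"
    and C: "\<And>n. eventually (\<lambda>x. x \<in> C n) (H n)"
    and R: "\<And>m n. eventually (\<lambda>x. eventually (R x) (H n)) (H m)"
  shows "\<exists>x. \<forall>n. x n \<in> C n \<and> (\<forall>m<n. R (x m) (x n))"
proof -
  define P where "P x n a \<longleftrightarrow> a \<in> C n \<and> (\<forall>k. eventually (R a) (H k)) \<and> (\<forall>m<n. R (x m) a)"
    for x n a
  have "\<exists>x. \<forall>n. P x n (x n)"
  proof (rule dependent_wellorder_choice)
    fix n x assume IH: "\<And>m. m < n \<Longrightarrow> P x m (x m)"
    have "eventually (\<lambda>a. \<forall>F\<in>range H. eventually (R a) F) (H n)"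
      using fin R by (intro eventually_ball_finite) auto
    moreover have "eventually (\<lambda>a. \<forall>m\<in>{..<n}. R (x m) a) (H n)"
      using IH by (intro eventually_ball_finite) (auto simp: P_def)
    ultimately have "eventually (P x n) (H n)"
      using C[of n] by eventually_elim (auto simp: P_def)
    then show "\<exists>a. P x n a"
      using nonbot eventually_happens' by blast
  qed (auto simp: P_def)
  then show ?thesis
    unfolding P_def by blast
qed

lemma first_countable_decreasing_base:
  assumes "first_countable T" "p \<in> topspace T"
  shows "\<exists>A :: nat \<Rightarrow> 'a set. (\<forall>n. openin T (A n) \<and> p \<in> A n) \<and>
    (\<forall>U. openin T U \<and> p \<in> U \<longrightarrow> (\<exists>N. \<forall>n\<ge>N. A n \<subseteq> U))"
proof -
  obtain \<B> where \<B>: "countable \<B>" "\<And>V. V \<in> \<B> \<Longrightarrow> openin T V"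
      "\<And>U. openin T U \<Longrightarrow> p \<in> U \<Longrightarrow> \<exists>V\<in>\<B>. p \<in> V \<and> V \<subseteq> U"
    using assms unfolding first_countable_def by meson
  define \<C> where "\<C> = {V \<in> \<B>. p \<in> V}"
  have C: "countable \<C>" "\<C> \<noteq> {}"
    using \<B>(1) \<B>(3)[OF openin_topspace assms(2)] by (auto simp: \<C>_def)
  define A where "A n = (\<Inter>k\<le>n. from_nat_into \<C> k)" for n
  have "from_nat_into \<C> k \<in> \<C>" for k
    by (rule from_nat_into[OF C(2)])
  then have "openin T (A n)" "p \<in> A n" for n
    using \<B>(2) unfolding A_def by (force simp: \<C>_def intro!: openin_INT2)+
  moreover have "\<exists>N. \<forall>n\<ge>N. A n \<subseteq> U" if U: "openin T U" "p \<in> U" for U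
  proof -
    obtain V where V: "V \<in> \<C>" "V \<subseteq> U"
      using \<B>(3)[OF U] by (auto simp: \<C>_def)
    then obtain N where "V = from_nat_into \<C> N"
      using from_nat_into_surj[OF C(1)] by metis
    then have "\<forall>n\<ge>N. A n \<subseteq> U"
      using V(2) by (auto simp: A_def)
    then show ?thesis by blast
  qed
  ultimately show ?thesis
    by blast
qed

text \<open>
  The two sequences are chosen alternately as one generic sequence, the \<open>n\<close>-th member of each inside the
  \<open>n\<close>-th set of a neighbourhood base of its limit.
\<close>

lemma generic_convergent_sequences:
  fixes T :: "'a topology"
  assumes T: "first_countable T"
    and F: "free_ultrafilter F" "limitin T (\<lambda>x. x) p F" and G: "free_ultrafilter G" "limitin T (\<lambda>x. x) p' G"
    and Q: "eventually Q F" "eventually Q G"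
    and sym: "\<And>x y. R x y \<Longrightarrow> R y x"
    and R: "eventually (\<lambda>x. eventually (R x) F) F" "eventually (\<lambda>x. eventually (R x) G) F"
      "eventually (\<lambda>x. eventually (R x) F) G" "eventually (\<lambda>x. eventually (R x) G) G"
  obtains s d where "limitin T s p sequentially" "limitin T d p' sequentially"
    "\<And>n. Q (s n)" "\<And>n. Q (d n)" "\<And>m n. m \<noteq> n \<Longrightarrow> R (s m) (s n)" "\<And>m n. m \<noteq> n \<Longrightarrow> R (d m) (d n)"
    "\<And>m n. R (s m) (d n)"
proof -
  obtain A :: "nat \<Rightarrow> 'a set" where A: "(\<forall>n. openin T (A n) \<and> p \<in> A n) \<and>
      (\<forall>U. openin T U \<and> p \<in> U \<longrightarrow> (\<exists>N. \<forall>n\<ge>N. A n \<subseteq> U))"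
    using first_countable_decreasing_base[OF T limitin_topspace[OF F(2)]] ..
  obtain B :: "nat \<Rightarrow> 'a set" where B: "(\<forall>n. openin T (B n) \<and> p' \<in> B n) \<and>
      (\<forall>U. openin T U \<and> p' \<in> U \<longrightarrow> (\<exists>N. \<forall>n\<ge>N. B n \<subseteq> U))"
    using first_countable_decreasing_base[OF T limitin_topspace[OF G(2)]] ..
  define H where "H n = (if even n then F else G)" for n :: nat
  define C where "C n = {x \<in> if even n then A (n div 2) else B (n div 2). Q x}" for n
  have "eventually (\<lambda>x. x \<in> A n) F" "eventually (\<lambda>x. x \<in> B n) G" for n
    using F(2) G(2) A B by (auto simp: limitin_def)
  then have "\<exists>x. \<forall>n. x n \<in> C n \<and> (\<forall>m<n. R (x m) (x n))"
    using F(1) G(1) R Q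
    by (intro generic_sequence[where H = H])
       (auto simp: H_def C_def free_ultrafilter_not_bot image_def eventually_conj_iff intro: finite_subset[of _ "{F, G}"])
  then obtain x where x: "\<And>n. x n \<in> C n" "\<And>m n. m < n \<Longrightarrow> R (x m) (x n)"
    by blast
  have R': "R (x m) (x n)" if "m \<noteq> n" for m n
    using x(2) sym that by (metis linorder_neqE_nat)
  define s d where "s n = x (2 * n)" and "d n = x (2 * n + 1)" for n
  have sA: "s n \<in> A n" "Q (s n)" and dB: "d n \<in> B n" "Q (d n)" for n
    using x(1)[of "2 * n"] x(1)[of "2 * n + 1"] by (auto simp: s_def d_def C_def)
  have "limitin T s p sequentially"
    using conjunct2[OF A] sA F(2) by (force simp: limitin_def eventually_sequentially)
  moreover have "limitin T d p' sequentially"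
    using conjunct2[OF B] dB G(2) by (force simp: limitin_def eventually_sequentially)
  moreover have "R (s m) (s n)" "R (d m) (d n)" if "m \<noteq> n" for m n
    using that by (auto simp: s_def d_def intro!: R')
  moreover have "R (s m) (d n)" for m n
    unfolding s_def d_def by (rule R') presburger
  ultimately show ?thesis
    using sA dB that by blast
qed

section \<open>The topology of a well-order\<close>

lemma openin_ord_topology_subbasis:
  "openin (ord_topology r) (Field r)"
  "b \<in> Field r \<Longrightarrow> openin (ord_topology r) (underS r b)"
  "b \<in> Field r \<Longrightarrow> openin (ord_topology r) (aboveS r b)"
  unfolding ord_topology_def by (auto intro!: topology_generated_by_Basis)

lemma Well_order_facts:
  assumes "Well_order r"
  shows "\<And>x. x \<in> Field r \<Longrightarrow> (x, x) \<in> r"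
    and "\<And>x y z. (x, y) \<in> r \<Longrightarrow> (y, z) \<in> r \<Longrightarrow> (x, z) \<in> r"
    and "\<And>x y. (x, y) \<in> r \<Longrightarrow> (y, x) \<in> r \<Longrightarrow> x = y"
    and "\<And>x y. x \<in> Field r \<Longrightarrow> y \<in> Field r \<Longrightarrow> (x, y) \<in> r \<or> (y, x) \<in> r"
proof -
  have R: "Refl r" "trans r" "antisym r" "Total r"
    using assms by (auto simp: order_on_defs)
  show refl: "(x, x) \<in> r" if "x \<in> Field r" for x
    using R(1) that by (simp add: refl_on_def)
  show "(x, z) \<in> r" if "(x, y) \<in> r" "(y, z) \<in> r" for x y z
    using R(2) that by (rule transD)
  show "x = y" if "(x, y) \<in> r" "(y, x) \<in> r" for x y
    using R(3) that by (rule antisymD)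
  show "(x, y) \<in> r \<or> (y, x) \<in> r" if "x \<in> Field r" "y \<in> Field r" for x y
    using R(4) that refl by (cases "x = y") (auto simp: total_on_def)
qed

text \<open>
  Closed initial segments are open because \<open>p\<close> is the last point or has an immediate successor.
\<close>

lemma openin_ord_topology_atMost:
  assumes r: "Well_order r" and p: "p \<in> Field r"
  shows "openin (ord_topology r) {x. (x, p) \<in> r}"
proof (cases "aboveS r p = {}")
  case True
  have "(x, p) \<in> r" if "x \<in> Field r" for x
  proof (cases "x = p")
    case False
    with True have "(p, x) \<notin> r"
      by (auto simp: aboveS_def)
    then show ?thesis
      using Well_order_facts(4)[OF r that p] by blast
  qed (simp add: Well_order_facts(1)[OF r p])
  then have "{x. (x, p) \<in> r} = Field r"
    by (auto simp: Field_def)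
  then show ?thesis
    by (simp add: openin_ord_topology_subbasis)
next
  case False
  have wo: "wo_rel r"
    using r by (simp add: wo_rel_def)
  define q where "q = wo_rel.minim r (aboveS r p)"
  have sub: "aboveS r p \<subseteq> Field r"
    by (auto simp: aboveS_def Field_def)
  have q: "q \<in> aboveS r p"
    unfolding q_def by (rule wo_rel.minim_in[OF wo sub False])
  have "(x, p) \<in> r \<longleftrightarrow> x \<in> underS r q" for x
  proof
    assume "(x, p) \<in> r"
    then show "x \<in> underS r q"
      using q Well_order_facts(2,3)[OF r] unfolding aboveS_def underS_def by blast
  next
    assume x: "x \<in> underS r q"
    show "(x, p) \<in> r"
    proof (rule ccontr)
      assume n: "(x, p) \<notin> r"
      have "x \<in> Field r"
        using x by (auto simp: underS_def Field_def)
      then have "(p, x) \<in> r"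
        using n Well_order_facts(4)[OF r _ p] by blast
      moreover have "x \<noteq> p"
        using n Well_order_facts(1)[OF r p] by blast
      ultimately have "x \<in> aboveS r p"
        by (simp add: aboveS_def)
      then have "(q, x) \<in> r"
        unfolding q_def by (rule wo_rel.minim_least[OF wo sub])
      then show False
        using x Well_order_facts(3)[OF r] by (auto simp: underS_def)
    qed
  qed
  then have "{x. (x, p) \<in> r} = underS r q"
    by blast
  moreover have "q \<in> Field r"
    using q sub by blast
  ultimately show ?thesis
    by (simp add: openin_ord_topology_subbasis)
qed

lemma openin_ord_topology_interval:
  assumes r: "Well_order r" and p: "p \<in> Field r" and b: "b \<in> Field r"
  shows "openin (ord_topology r) {x. (x, p) \<in> r \<and> (b, x) \<in> r \<and> x \<noteq> b}"
proof -
  have "{x. (x, p) \<in> r \<and> (b, x) \<in> r \<and> x \<noteq> b} = {x. (x, p) \<in> r} \<inter> aboveS r b"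
    by (auto simp: aboveS_def)
  then show ?thesis
    using openin_ord_topology_atMost[OF r p] openin_ord_topology_subbasis(3)[OF b]
    by (simp add: openin_Int)
qed

lemma Hausdorff_ord_topology:
  assumes r: "Well_order r"
  shows "Hausdorff_space (ord_topology r)"
proof -
  note R = Well_order_facts[OF r]
  have sep: "openin (ord_topology r) {x. (x, p) \<in> r} \<and> openin (ord_topology r) (aboveS r p) \<and>
      p \<in> {x. (x, p) \<in> r} \<and> q \<in> aboveS r p \<and> disjnt {x. (x, p) \<in> r} (aboveS r p)"
    if "(p, q) \<in> r" "p \<noteq> q" for p q
  proof -
    have "p \<in> Field r"
      using that by (auto simp: Field_def)
    then show ?thesis
      using that openin_ord_topology_atMost[OF r, of p] openin_ord_topology_subbasis(3)[of p r]
        R(1)[of p] R(3) by (simp add: aboveS_def disjnt_iff) blast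
  qed
  show ?thesis
    unfolding Hausdorff_space_def
  proof (intro allI impI)
    fix p q assume pq: "p \<in> topspace (ord_topology r) \<and> q \<in> topspace (ord_topology r) \<and> p \<noteq> q"
    then consider "(p, q) \<in> r" | "(q, p) \<in> r"
      using R(4) by auto
    then show "\<exists>U V. openin (ord_topology r) U \<and> openin (ord_topology r) V \<and> p \<in> U \<and> q \<in> V \<and> disjnt U V"
    proof cases
      case 1
      then show ?thesis using sep pq by blast
    next
      case 2
      then show ?thesis using sep pq disjnt_sym by metis
    qed
  qed
qed

text \<open>
  The intervals that end in \<open>p\<close> form a neighbourhood base; since they are nested, the base property
  passes from the open rays to their finite intersections.
\<close>

lemma first_countable_ord_topology:
  assumes r: "Well_order r" and count: "countable (Field r)"
  shows "first_countable (ord_topology r)"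
  unfolding first_countable_def topspace_ord_topology
proof
  fix p assume p: "p \<in> Field r"
  note R = Well_order_facts[OF r]
  define I where "I b = {x. (x, p) \<in> r \<and> (b, x) \<in> r \<and> x \<noteq> b}" for b
  define \<B> where "\<B> = insert {x. (x, p) \<in> r} (I ` underS r p)"
  have nest: "V \<subseteq> W \<or> W \<subseteq> V" if mem: "V \<in> \<B>" "W \<in> \<B>" for V W
  proof -
    have "I b \<subseteq> I b' \<or> I b' \<subseteq> I b" if "b \<in> underS r p" "b' \<in> underS r p" for b b'
    proof -
      have "I x \<subseteq> I y" if "(y, x) \<in> r" for x y
        using that R(2,3) unfolding I_def by blast
      moreover have "(b, b') \<in> r \<or> (b', b) \<in> r"
        using that by (intro R(4)) (auto simp: underS_def Field_def)
      ultimately show ?thesis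
        by blast
    qed
    note nest_I = this
    have top: "V \<subseteq> {x. (x, p) \<in> r}" if "V \<in> \<B>" for V
      using that by (auto simp: \<B>_def I_def)
    show ?thesis
    proof (cases "V = {x. (x, p) \<in> r} \<or> W = {x. (x, p) \<in> r}")
      case True
      then show ?thesis
        using top[OF mem(1)] top[OF mem(2)] by metis
    next
      case False
      then obtain b b' where "b \<in> underS r p" "V = I b" "b' \<in> underS r p" "W = I b'"
        using mem unfolding \<B>_def by blast
      then show ?thesis
        using nest_I by simp
    qed
  qed
  have mem: "p \<in> V" if "V \<in> \<B>" for V
    using that R(1)[OF p] by (auto simp: \<B>_def I_def underS_def)
  have "underS r p \<subseteq> Field r"
    by (auto simp: underS_def Field_def)
  then have "countable \<B>"
    using count countable_subset by (auto simp: \<B>_def)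
  moreover have "openin (ord_topology r) V" if "V \<in> \<B>" for V
    using that \<open>underS r p \<subseteq> Field r\<close> openin_ord_topology_atMost[OF r p]
      openin_ord_topology_interval[OF r p] by (auto simp: \<B>_def I_def)
  moreover have "\<exists>V\<in>\<B>. p \<in> V \<and> V \<subseteq> U" if "openin (ord_topology r) U" "p \<in> U" for U
  proof -
    have "generate_topology_on (insert (Field r) (underS r ` Field r \<union> aboveS r ` Field r)) U"
      using that(1) by (simp add: ord_topology_def openin_topology_generated_by_iff)
    then have "p \<in> U \<longrightarrow> (\<exists>V\<in>\<B>. V \<subseteq> U)"
    proof induction
      case (Int a b)
      show ?case
      proof (intro impI)
        assume "p \<in> a \<inter> b"
        with Int obtain V W where VW: "V \<in> \<B>" "V \<subseteq> a" "W \<in> \<B>" "W \<subseteq> b"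
          by blast
        with nest[of V W] consider "V \<subseteq> W" | "W \<subseteq> V"
          by blast
        then show "\<exists>V\<in>\<B>. V \<subseteq> a \<inter> b"
          by cases (use VW in blast)+
      qed
    next
      case (UN K)
      show ?case
      proof
        assume "p \<in> \<Union>K"
        then obtain k where k: "k \<in> K" "p \<in> k" by blast
        with UN.IH[of k] obtain V where "V \<in> \<B>" "V \<subseteq> k" by blast
        with k(1) show "\<exists>V\<in>\<B>. V \<subseteq> \<Union>K" by blast
      qed
    next
      case (Basis S)
      then consider "S = Field r" | b where "b \<in> Field r" "S = underS r b"
        | b where "b \<in> Field r" "S = aboveS r b" by auto
      then show ?case
      proof cases
        case 1
        then have "{x. (x, p) \<in> r} \<subseteq> S"
          by (auto simp: Field_def)
        then show ?thesis by (auto simp: \<B>_def)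
      next
        case 2
        then have "{x. (x, p) \<in> r} \<subseteq> S" if "p \<in> S"
          using that R(2,3) unfolding underS_def by blast
        then show ?thesis by (auto simp: \<B>_def)
      next
        case 3
        then have "I b \<subseteq> S \<and> b \<in> underS r p" if "p \<in> S"
          using that by (auto simp: I_def aboveS_def underS_def)
        then show ?thesis by (auto simp: \<B>_def)
      qed
    qed simp
    then show ?thesis
      using that(2) mem by blast
  qed
  ultimately show "\<exists>\<B>. countable \<B> \<and> (\<forall>V\<in>\<B>. openin (ord_topology r) V) \<and>
      (\<forall>U. openin (ord_topology r) U \<and> p \<in> U \<longrightarrow> (\<exists>V\<in>\<B>. p \<in> V \<and> V \<subseteq> U))"
    by blast
qed

lemma limitin_ord_topology:
  assumes r: "Well_order r" and p: "p \<in> Field r" and f: "\<And>n. (f n, p) \<in> r"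
    and cofinal: "\<And>b. b \<in> underS r p \<Longrightarrow> eventually (\<lambda>n. f n \<in> aboveS r b) F"
  shows "limitin (ord_topology r) f p F"
  unfolding limitin_def topspace_ord_topology
proof (intro conjI allI impI p)
  note R = Well_order_facts[OF r]
  fix U assume U: "openin (ord_topology r) U \<and> p \<in> U"
  then have "generate_topology_on (insert (Field r) (underS r ` Field r \<union> aboveS r ` Field r)) U"
    by (simp add: ord_topology_def openin_topology_generated_by_iff)
  then have "p \<in> U \<longrightarrow> eventually (\<lambda>n. f n \<in> U) F"
  proof induction
    case (Int a b)
    then show ?case by (simp add: eventually_conj_iff)
  next
    case (UN K)
    show ?case
    proof
      assume "p \<in> \<Union>K"
      then obtain k where "k \<in> K" "p \<in> k" by blast
      with UN have "eventually (\<lambda>n. f n \<in> k) F" by blast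
      then show "eventually (\<lambda>n. f n \<in> \<Union>K) F"
        by (rule eventually_mono) (use \<open>k \<in> K\<close> in blast)
    qed
  next
    case (Basis S)
    then consider "S = Field r" | b where "b \<in> Field r" "S = underS r b"
      | b where "b \<in> Field r" "S = aboveS r b" by auto
    then show ?case
    proof cases
      case 1
      then have "f n \<in> S" for n
        using f[of n] by (auto simp: Field_def)
      then show ?thesis by simp
    next
      case 2
      then have "f n \<in> S" if "p \<in> S" for n
        using that f[of n] R(2,3) unfolding underS_def by blast
      then show ?thesis by simp
    next
      case 3
      then show ?thesis
        using cofinal[of b] by (auto simp: aboveS_def underS_def)
    qed
  qed simp
  then show "eventually (\<lambda>n. f n \<in> U) F"
    using U by blast
qed

lemma mem_ord_prod_natLeq_on:
  "((x, i), (y, j)) \<in> r \<cdot>\<^sub>o natLeq_on n \<longleftrightarrow>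
    x \<in> Field r \<and> y \<in> Field r \<and> i < n \<and> j < n \<and> (i < j \<or> i = j \<and> (x, y) \<in> r)"
  unfolding ord_prod_def Field_natLeq_on by auto

lemma mem_ord_prod_natLeq:
  "((x, i), (y, j)) \<in> r \<cdot>\<^sub>o natLeq \<longleftrightarrow>
    x \<in> Field r \<and> y \<in> Field r \<and> (i < j \<or> i = j \<and> (x, y) \<in> r)"
  unfolding ord_prod_def Field_natLeq by (auto simp: natLeq_def)

lemma mem_natLeq: "(x, y) \<in> natLeq \<longleftrightarrow> x \<le> y"
  by (simp add: natLeq_def)

lemmas mem_ord_prod = mem_ord_prod_natLeq_on mem_ord_prod_natLeq mem_natLeq Field_ord_prod
  Field_natLeq Field_natLeq_on

section \<open>The space \<open>\<omega> \<cdot> 2\<close>\<close>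

lemma finite_limitin_sequentially:
  assumes "limitin T s p sequentially" "openin T U" "p \<in> U"
  shows "finite {n. s n \<notin> U}"
proof -
  have "eventually (\<lambda>n. s n \<in> U) sequentially"
    using assms by (simp add: limitin_def)
  then show ?thesis
    by (simp add: eventually_cofinite flip: cofinite_eq_sequentially)
qed

text \<open>
  The open sets of such a space depend only on how \<open>p\<close>, \<open>s\<close> and \<open>d\<close> label the points, so any two spaces
  of this kind are homeomorphic. This characterizes the topology of \<open>\<omega> \<cdot> 2\<close>.
\<close>

lemma openin_converging_plus_discrete:
  fixes T :: "'a topology" and s d :: "nat \<Rightarrow> 'a"
  assumes T: "t1_space T" and space: "topspace T = insert p (range s \<union> range d)"
    and iso: "\<And>n. openin T {s n}" "\<And>n. openin T {d n}"
    and lim: "limitin T s p sequentially"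
    and N: "openin T N" "p \<in> N" "range d \<inter> N = {}"
  shows "openin T U \<longleftrightarrow> U \<subseteq> topspace T \<and> (p \<in> U \<longrightarrow> finite {n. s n \<notin> U})"
proof
  assume U: "openin T U"
  have "finite {n. s n \<notin> U}" if "p \<in> U"
    using lim U that by (rule finite_limitin_sequentially)
  then show "U \<subseteq> topspace T \<and> (p \<in> U \<longrightarrow> finite {n. s n \<notin> U})"
    using openin_subset[OF U] by blast
next
  assume U: "U \<subseteq> topspace T \<and> (p \<in> U \<longrightarrow> finite {n. s n \<notin> U})"
  have single: "openin T {x}" if "x \<in> U" "x \<noteq> p" for x
    using that U iso by (auto simp: space)
  show "openin T U"
  proof (cases "p \<in> U")
    case False
    then have "U = (\<Union>x\<in>U. {x})" "\<And>x. x \<in> U \<Longrightarrow> openin T {x}"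
      using single by auto
    then show ?thesis
      by (metis (no_types, lifting) imageE openin_Union)
  next
    case True
    define M where "M = N - s ` {n. s n \<notin> U}"
    have "finite (s ` {n. s n \<notin> U})" "s ` {n. s n \<notin> U} \<subseteq> topspace T"
      using U True by (auto simp: space)
    then have "closedin T (s ` {n. s n \<notin> U})"
      using T by (simp add: t1_space_closedin_finite)
    then have M: "openin T M"
      unfolding M_def using N(1) by (rule openin_diff[rotated])
    have "N \<subseteq> topspace T"
      using N(1) by (rule openin_subset)
    then have "M \<subseteq> U"
      using N(3) True by (auto simp: M_def space)
    moreover have "p \<in> M"
      using N(2) True by (auto simp: M_def)
    ultimately show ?thesis
      using M single unfolding openin_subopen[of T U] by blast
  qed
qed

abbreviation omega_times_2 :: "(nat \<times> nat) rel" where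
  "omega_times_2 \<equiv> natLeq \<cdot>\<^sub>o natLeq_on 2"

lemma Well_order_omega_times_2: "Well_order omega_times_2"
  by (intro Well_order_ord_prod natLeq_Well_order natLeq_on_Well_order)

text \<open>
  The point \<open>(0, 1)\<close> is the ordinal \<open>\<omega>\<close>, the points \<open>(n, 0)\<close> are the ordinals below it, and the
  points \<open>(Suc n, 1)\<close> are the ordinals above it.
\<close>

lemma openin_omega_times_2:
  "openin (ord_topology omega_times_2) U \<longleftrightarrow>
    U \<subseteq> Field omega_times_2 \<and> ((0, 1) \<in> U \<longrightarrow> finite {n. (n, 0) \<notin> U})"
proof -
  note wo = Well_order_omega_times_2
  let ?T = "ord_topology omega_times_2"
  let ?s = "\<lambda>n::nat. (n, 0::nat)" and ?d = "\<lambda>n. (Suc n, 1::nat)"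
  have field: "Field omega_times_2 = insert (0, 1) (range ?s \<union> range ?d)"
  proof -
    have "x \<in> insert (0, 1) (range ?s \<union> range ?d)" if "x \<in> UNIV \<times> {i. i < 2}" for x :: "nat \<times> nat"
      using that by (cases x; cases "snd x"; cases "fst x") auto
    then show ?thesis
      by (auto simp: mem_ord_prod)
  qed
  have iso: "openin ?T {(n, i)}" if "i < 2" "n > 0" for n i
  proof -
    have "{(n, i)} = {x. (x, (n, i)) \<in> omega_times_2 \<and> ((n - 1, i), x) \<in> omega_times_2 \<and> x \<noteq> (n - 1, i)}"
      using that by (auto simp: mem_ord_prod)
    then show ?thesis
      using openin_ord_topology_interval[OF wo, of "(n, i)" "(n - 1, i)"] that
      by (simp add: mem_ord_prod)
  qed
  have "{(0, 0)} = {x. (x, (0, 0)) \<in> omega_times_2}"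
    by (auto simp: mem_ord_prod)
  then have iso0: "openin ?T {(0, 0)}"
    using openin_ord_topology_atMost[OF wo, of "(0, 0)"] by (simp add: mem_ord_prod)
  have "openin ?T U \<longleftrightarrow> U \<subseteq> topspace ?T \<and> ((0, 1) \<in> U \<longrightarrow> finite {n. ?s n \<notin> U})"
  proof (rule openin_converging_plus_discrete[where d = ?d and N = "{x. (x, (0, 1)) \<in> omega_times_2}"])
    show "t1_space ?T"
      by (intro Hausdorff_imp_t1_space Hausdorff_ord_topology wo)
    show "topspace ?T = insert (0, 1) (range ?s \<union> range ?d)"
      using field by simp
    show "openin ?T {?s n}" for n
      using iso[of 0 n] iso0 by (cases "n = 0") auto
    show "openin ?T {?d n}" for n
      using iso[of 1 "Suc n"] by simp
    show "limitin ?T ?s (0, 1) sequentially"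
    proof (rule limitin_ord_topology[OF wo])
      fix b assume b: "b \<in> underS omega_times_2 (0, 1)"
      obtain m i where "b = (m, i)" by (cases b)
      with b have "b = (m, 0)"
        by (auto simp: underS_def mem_ord_prod)
      then have "?s n \<in> aboveS omega_times_2 b" if "n > m" for n
        using that by (auto simp: aboveS_def mem_ord_prod)
      then show "eventually (\<lambda>n. ?s n \<in> aboveS omega_times_2 b) sequentially"
        using eventually_gt_at_top[of m] by (rule eventually_mono[rotated])
    qed (auto simp: mem_ord_prod)
    show "openin ?T {x. (x, (0, 1)) \<in> omega_times_2}"
      by (rule openin_ord_topology_atMost[OF wo]) (simp add: mem_ord_prod)
  qed (auto simp: mem_ord_prod)
  then show ?thesis
    by simp
qed

lemma Hausdorff_limitin_finite_neighbourhood: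
  assumes T: "Hausdorff_space T" and lim: "limitin T s p sequentially"
    and x: "x \<in> topspace T" "x \<noteq> p"
  shows "\<exists>V. openin T V \<and> x \<in> V \<and> finite {n. s n \<in> V}"
proof -
  have "p \<in> topspace T"
    using lim by (rule limitin_topspace)
  then obtain V W where VW: "openin T V" "openin T W" "x \<in> V" "p \<in> W" "disjnt V W"
    using T x unfolding Hausdorff_space_def by metis
  have "{n. s n \<in> V} \<subseteq> {n. s n \<notin> W}"
    using VW by (auto simp: disjnt_iff)
  then show ?thesis
    using VW finite_limitin_sequentially[OF lim VW(2,4)] finite_subset by blast
qed

text \<open>
  Leaving out \<open>p'\<close> makes \<open>d\<close> closed and discrete: every point other than the two limits, and also
  \<open>p\<close> as far as \<open>d\<close> is concerned, has a neighbourhood that contains only finitely many members of the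
  sequences.
\<close>

lemma two_convergent_sequences_homeomorphic:
  assumes T: "Hausdorff_space T"
    and s: "limitin T s p sequentially" "range s \<subseteq> topspace T" "inj s" "p \<notin> range s" "p' \<notin> range s"
    and d: "limitin T d p' sequentially" "range d \<subseteq> topspace T" "inj d" "p \<notin> range d" "p' \<notin> range d"
    and disj: "p \<noteq> p'" "range s \<inter> range d = {}"
  shows "subtopology T (insert p (range s \<union> range d)) homeomorphic_space ord_topology omega_times_2"
proof -
  define X where "X = insert p (range s \<union> range d)"
  define S where "S = subtopology T X"
  have pT: "p \<in> topspace T"
    using s(1) by (rule limitin_topspace)
  have space: "topspace S = X"
    using s d pT by (auto simp: S_def X_def)
  have t1: "t1_space S"
    unfolding S_def using T by (intro Hausdorff_imp_t1_space Hausdorff_space_subtopology)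
  have minus: "openin S (U - M)" if "openin S U" "finite M" "M \<subseteq> X" for U M
    using that t1 by (intro openin_diff) (auto simp: t1_space_closedin_finite space)
  have iso: "openin S {x}" if x: "x \<in> X" "x \<noteq> p" "x \<noteq> p'" for x
  proof -
    have xT: "x \<in> topspace T"
      using x(1) s d pT by (auto simp: X_def)
    obtain V where V: "openin T V" "x \<in> V" "finite {n. s n \<in> V}"
      using Hausdorff_limitin_finite_neighbourhood[OF T s(1) xT x(2)] by blast
    obtain W where W: "openin T W" "x \<in> W" "finite {n. d n \<in> W}"
      using Hausdorff_limitin_finite_neighbourhood[OF T d(1) xT x(3)] by blast
    define M where "M = V \<inter> W \<inter> X - {x}"
    have "M \<subseteq> insert p (s ` {n. s n \<in> V} \<union> d ` {n. d n \<in> W})"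
      by (auto simp: M_def X_def)
    then have "finite M"
      using V(3) W(3) by (simp add: finite_subset)
    moreover have "openin S (V \<inter> W \<inter> X)"
      unfolding S_def using V(1) W(1) by (intro openin_subtopology_Int openin_Int)
    ultimately have "openin S (V \<inter> W \<inter> X - M)"
      by (intro minus) (auto simp: M_def)
    moreover have "V \<inter> W \<inter> X - M = {x}"
      using V(2) W(2) x(1) by (auto simp: M_def)
    ultimately show ?thesis by simp
  qed
  obtain V where V: "openin T V" "p \<in> V" "finite {n. d n \<in> V}"
    using Hausdorff_limitin_finite_neighbourhood[OF T d(1) pT disj(1)] by blast
  have openS: "openin S U \<longleftrightarrow> U \<subseteq> X \<and> (p \<in> U \<longrightarrow> finite {n. s n \<notin> U})" for U
    unfolding space[symmetric]
  proof (rule openin_converging_plus_discrete[where d = d and N = "V \<inter> X - d ` {n. d n \<in> V}"])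
    show "limitin S s p sequentially"
      unfolding S_def using s(1) by (auto simp: limitin_subtopology X_def)
    have "openin S (V \<inter> X)"
      unfolding S_def using V(1) by (rule openin_subtopology_Int)
    then show "openin S (V \<inter> X - d ` {n. d n \<in> V})"
      using V(3) by (intro minus) (auto simp: X_def)
    show "topspace S = insert p (range s \<union> range d)"
      unfolding space X_def ..
    show "openin S {s n}" "openin S {d n}" for n
      using s(4,5) d(4,5) by (auto intro!: iso simp: X_def)
    show "p \<in> V \<inter> X - d ` {n. d n \<in> V}"
      using V(2) d(4) by (auto simp: X_def)
  qed (use t1 in auto)
  define f where "f x = (if snd x = 0 then s (fst x) else if fst x = 0 then p else d (fst x - 1))"
    for x :: "nat \<times> nat"
  have field: "Field omega_times_2 = UNIV \<times> {i. i < 2}"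
    by (simp add: mem_ord_prod)
  have f: "f (n, 0) = s n" "f (0, Suc 0) = p" "f (Suc n, Suc 0) = d n" for n
    by (auto simp: f_def)
  have less2: "i < 2 \<longleftrightarrow> i = 0 \<or> i = Suc 0" for i :: nat
    by auto
  have inj: "inj_on f (Field omega_times_2)"
  proof (rule inj_onI)
    fix x y assume xy: "x \<in> Field omega_times_2" "y \<in> Field omega_times_2" "f x = f y"
    obtain a i b j where [simp]: "x = (a, i)" "y = (b, j)"
      by (cases x, cases y)
    have "i = 0 \<or> i = Suc 0" "j = 0 \<or> j = Suc 0"
      using xy(1,2) by (auto simp: field)
    moreover have "s m \<noteq> d n" "s m \<noteq> p" "d m \<noteq> p" "p \<noteq> s m" "p \<noteq> d m" "d m \<noteq> s n" for m n
      using s(4) d(4) disj(2) by (metis disjoint_iff rangeI)+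
    ultimately show "x = y"
      using xy(3) s(3) d(3) by (cases a; cases b) (auto simp: f inj_eq)
  qed
  have image: "f ` Field omega_times_2 = X"
  proof
    show "f ` Field omega_times_2 \<subseteq> X"
      by (auto simp: field f_def X_def)
    have "s n \<in> f ` Field omega_times_2" "d n \<in> f ` Field omega_times_2"
        "p \<in> f ` Field omega_times_2" for n
      using imageI[of "(n, 0)" "Field omega_times_2" f] imageI[of "(Suc n, Suc 0)" "Field omega_times_2" f]
        imageI[of "(0, Suc 0)" "Field omega_times_2" f] by (auto simp: f field)
    then show "X \<subseteq> f ` Field omega_times_2"
      by (auto simp: X_def)
  qed
  have opens: "openin S (f ` U) \<longleftrightarrow> openin (ord_topology omega_times_2) U"
    if U: "U \<subseteq> Field omega_times_2" for U
  proof -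
    have mem: "f x \<in> f ` U \<longleftrightarrow> x \<in> U" if "x \<in> Field omega_times_2" for x
      using inj U that by (meson inj_on_image_mem_iff)
    have "p \<in> f ` U \<longleftrightarrow> (0, 1) \<in> U"
      using mem[of "(0, 1)"] by (simp add: f field)
    moreover have "s n \<in> f ` U \<longleftrightarrow> (n, 0) \<in> U" for n
      using mem[of "(n, 0)"] by (simp add: f field)
    moreover have "f ` U \<subseteq> X"
      using U image by blast
    ultimately show ?thesis
      using U by (simp add: openS openin_omega_times_2)
  qed
  have "homeomorphic_map (ord_topology omega_times_2) S f"
  proof (rule bijective_open_imp_homeomorphic_map)
    show "continuous_map (ord_topology omega_times_2) S f"
      unfolding continuous_map_def
    proof (intro conjI allI impI)
      show "f \<in> topspace (ord_topology omega_times_2) \<rightarrow> topspace S"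
        using image by (auto simp: space)
      fix V assume V: "openin S V"
      define U where "U = {x \<in> topspace (ord_topology omega_times_2). f x \<in> V}"
      have "V \<subseteq> X"
        using openin_subset[OF V] space by simp
      then have "f ` U = V"
        using image by (auto simp: U_def)
      then show "openin (ord_topology omega_times_2) U"
        using opens[of U] V by (simp add: U_def)
    qed
    show "open_map (ord_topology omega_times_2) S f"
      unfolding open_map_def
    proof (intro allI impI)
      fix U assume U: "openin (ord_topology omega_times_2) U"
      then have "U \<subseteq> Field omega_times_2"
        using openin_subset[OF U] by simp
      then show "openin S (f ` U)"
        using opens U by blast
    qed
  qed (use inj image space in auto)
  then show ?thesis
    using homeomorphic_map_imp_homeomorphic_space homeomorphic_space_sym
    unfolding S_def X_def by blast
qed

text \<open>
  The property of \<open>\<omega> \<cdot> 2\<close> that the colouring of the lower bound destroys. The limit point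
  is \<open>\<omega>\<close>, and \<open>N\<close> is the set of the ordinals up to \<open>\<omega>\<close>.
\<close>

lemma homeomorphic_omega_times_2_limit_point:
  assumes "S homeomorphic_space ord_topology omega_times_2"
  obtains p N where "p \<in> topspace S" "\<And>U. openin S U \<Longrightarrow> p \<in> U \<Longrightarrow> \<exists>x\<in>U. x \<noteq> p"
    "openin S N" "p \<in> N" "infinite (topspace S - N)"
proof -
  let ?T = "ord_topology omega_times_2"
  obtain f where f: "homeomorphic_map ?T S f"
    using iffD1[OF homeomorphic_space_sym assms] unfolding homeomorphic_space by blast
  have inj: "inj_on f (Field omega_times_2)" and image: "f ` Field omega_times_2 = topspace S"
    using homeomorphic_imp_injective_map[OF f] homeomorphic_imp_surjective_map[OF f] by auto
  have field: "(n, i) \<in> Field omega_times_2 \<longleftrightarrow> i < 2" for n i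
    by (simp add: mem_ord_prod)
  have limit: "\<exists>x\<in>U. x \<noteq> f (0, 1)" if U: "openin S U" "f (0, 1) \<in> U" for U
  proof -
    have "openin ?T {x \<in> topspace ?T. f x \<in> U}"
      using homeomorphic_imp_continuous_map[OF f] U(1) by (rule openin_continuous_map_preimage)
    then have "finite {n. (n, 0) \<notin> {x \<in> topspace ?T. f x \<in> U}}"
      unfolding openin_omega_times_2 using U(2) by (simp add: field)
    then have "{n. (n, 0) \<notin> {x \<in> topspace ?T. f x \<in> U}} \<noteq> UNIV"
      by (metis infinite_UNIV_nat)
    then obtain n where n: "(n, 0) \<in> {x \<in> topspace ?T. f x \<in> U}"
      by blast
    have "f (n, 0) \<noteq> f (0, 1)"
      using inj_onD[OF inj, of "(n, 0)" "(0, 1)"] by (auto simp: field)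
    then show ?thesis
      using n by blast
  qed
  define M :: "(nat \<times> nat) set" where "M = insert (0, 1) (range (\<lambda>n. (n, 0)))"
  have M: "M \<subseteq> Field omega_times_2"
    by (auto simp: M_def field)
  then have "openin ?T M"
    by (auto simp: openin_omega_times_2 M_def)
  then have "openin S (f ` M)"
    using homeomorphic_map_openness[OF f] M by simp
  moreover have "f ` range (\<lambda>n. (Suc n, 1)) \<subseteq> topspace S - f ` M"
  proof -
    have D: "range (\<lambda>n. (Suc n, 1)) \<subseteq> Field omega_times_2"
      by (auto simp: field)
    have "range (\<lambda>n. (Suc n, 1)) \<inter> M = {}"
      by (auto simp: M_def)
    then have "f ` range (\<lambda>n. (Suc n, 1)) \<inter> f ` M = {}"
      using inj_on_image_Int[OF inj D M] by simp
    then show ?thesis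
      using D image by blast
  qed
  moreover have "infinite (f ` range (\<lambda>n. (Suc n, 1 :: nat)))"
  proof -
    have "inj_on f (range (\<lambda>n. (Suc n, 1)))"
      by (rule inj_on_subset[OF inj]) (auto simp: field)
    moreover have "infinite (range (\<lambda>n. (Suc n, 1 :: nat)))"
      by (rule range_inj_infinite) (auto simp: inj_def)
    ultimately show ?thesis
      by (simp add: finite_image_iff)
  qed
  ultimately have "infinite (topspace S - f ` M)"
    using finite_subset by blast
  moreover have "f (0, 1) \<in> topspace S"
    using image field[of 0 1] by auto
  ultimately show ?thesis
    using limit \<open>openin S (f ` M)\<close> by (intro that[of "f (0, 1)" "f ` M"]) (simp_all add: M_def)
qed

section \<open>Triangle-free colourings\<close>

lemma Ramsey_ordered_pairs:
  fixes I :: "nat set"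
  assumes "infinite I"
  shows "\<exists>J \<subseteq> I. infinite J \<and>
    ((\<forall>i\<in>J. \<forall>j\<in>J. i < j \<longrightarrow> P i j) \<or> (\<forall>i\<in>J. \<forall>j\<in>J. i < j \<longrightarrow> \<not> P i j))"
proof -
  define f where "f e = (if P (Min e) (Max e) then 0 else 1 :: nat)" for e
  have f: "\<forall>i\<in>I. \<forall>j\<in>I. i \<noteq> j \<longrightarrow> f {i, j} < 2"
    by (simp add: f_def)
  obtain J t where J: "J \<subseteq> I" "infinite J" "\<forall>i\<in>J. \<forall>j\<in>J. i \<noteq> j \<longrightarrow> f {i, j} = t"
    using Ramsey2[OF assms, of f 2] f by blast
  have "f {i, j} = (if P i j then 0 else 1)" if "i < j" for i j
    using that by (simp add: f_def max_def min_def)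
  then have "\<forall>i\<in>J. \<forall>j\<in>J. i < j \<longrightarrow> (if P i j then 0 else 1) = t"
    using J(3) by (metis nat_neq_iff)
  then have "(\<forall>i\<in>J. \<forall>j\<in>J. i < j \<longrightarrow> P i j) \<or> (\<forall>i\<in>J. \<forall>j\<in>J. i < j \<longrightarrow> \<not> P i j)"
    by (cases "t = 0") (auto split: if_splits)
  then show ?thesis
    using J(1,2) by blast
qed

lemma infinite_nat_three_elements:
  assumes "infinite (J :: nat set)"
  obtains i j k where "i \<in> J" "j \<in> J" "k \<in> J" "i < j" "j < k"
  using assms unfolding infinite_nat_iff_unbounded by metis

locale triangle_free =
  fixes blue :: "'a \<Rightarrow> 'a \<Rightarrow> bool"
  assumes blue_sym: "blue x y \<Longrightarrow> blue y x"
    and no_triangle: "blue x y \<Longrightarrow> blue x z \<Longrightarrow> blue y z \<Longrightarrow> False"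
begin

text \<open>
  The two quantifiers do not commute, so that there can be an arrow in one direction only.
\<close>

definition arrow :: "'a filter \<Rightarrow> 'a filter \<Rightarrow> bool"
  where "arrow F G \<longleftrightarrow> eventually (\<lambda>x. eventually (blue x) G) F"

lemma no_arrow_in_neighbourhood:
  assumes "F \<noteq> bot" "G \<noteq> bot" "eventually (blue x) F" "eventually (blue x) G"
  shows "\<not> arrow F G"
proof
  assume "arrow F G"
  then have "eventually (\<lambda>y. blue x y \<and> eventually (blue y) G) F"
    using assms(3) by (auto simp: arrow_def eventually_conj_iff)
  then obtain y where y: "blue x y" "eventually (blue y) G"
    using assms(1) eventually_happens' by blast
  then have "eventually (\<lambda>z. blue x z \<and> blue y z) G"
    using assms(4) by (auto simp: eventually_conj_iff)
  then obtain z where "blue x z" "blue y z"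
    using assms(2) eventually_happens' by blast
  with y show False
    using no_triangle by blast
qed

text \<open>
  Almost every point of \<open>F\<close> is near both \<open>G\<close> and \<open>H\<close>. Taking the three to be equal shows that
  there is no arrow from a filter to itself.
\<close>

lemma no_transitive_triangle:
  assumes "F \<noteq> bot" "G \<noteq> bot" "H \<noteq> bot" and "arrow F G" "arrow F H"
  shows "\<not> arrow G H"
proof -
  have "eventually (\<lambda>x. eventually (blue x) G \<and> eventually (blue x) H) F"
    using assms by (auto simp: arrow_def eventually_conj_iff)
  then obtain x where "eventually (blue x) G" "eventually (blue x) H"
    using assms(1) eventually_happens' by blast
  then show ?thesis
    using assms no_arrow_in_neighbourhood by blast
qed

lemma adjacent_not_both_near:
  assumes "F \<noteq> bot" "blue x y" "eventually (blue x) F"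
  shows "\<not> eventually (blue y) F"
proof
  assume "eventually (blue y) F"
  then have "eventually (\<lambda>z. blue x z \<and> blue y z) F"
    using assms by (auto simp: eventually_conj_iff)
  then obtain z where "blue x z" "blue y z"
    using assms(1) eventually_happens' by blast
  then show False
    using assms(2) no_triangle by blast
qed

text \<open>
  For ultrafilters, the absence of an arrow from \<open>F\<close> to \<open>G\<close> means that almost every point of \<open>F\<close> is
  nonadjacent to almost every point of \<open>G\<close>. As there are no arrows within \<open>F\<close> and within \<open>G\<close> either, generic
  sequences from \<open>F\<close> and \<open>G\<close> are red together, and also red to \<open>p\<close>.
\<close>

lemma red_copy_of_omega_times_2:
  assumes T: "Hausdorff_space T" "first_countable T"
    and F: "free_ultrafilter F" "limitin T (\<lambda>x. x) p F" "\<not> eventually (blue p) F"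
    and G: "free_ultrafilter G" "limitin T (\<lambda>x. x) p' G" "\<not> eventually (blue p) G"
    and neq: "p \<noteq> p'" and FG: "\<not> arrow F G" "\<not> arrow G F"
  shows "\<exists>X \<subseteq> topspace T. subtopology T X homeomorphic_space ord_topology omega_times_2 \<and>
    (\<forall>x\<in>X. \<forall>y\<in>X. x \<noteq> y \<longrightarrow> \<not> blue x y)"
proof -
  define R where "R x y \<longleftrightarrow> x \<noteq> y \<and> \<not> blue x y" for x y
  define Q where "Q x \<longleftrightarrow> x \<in> topspace T \<and> x \<noteq> p \<and> x \<noteq> p' \<and> \<not> blue p x" for x
  have QF: "eventually Q F" if "free_ultrafilter F" "limitin T (\<lambda>x. x) a F" "\<not> eventually (blue p) F" for F a
  proof -
    have "eventually (\<lambda>x. x \<in> topspace T) F"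
      using that(2) by (auto simp: limitin_def)
    then show ?thesis
      using that(1,3) free_ultrafilter_neq[OF that(1)]
      by (simp add: Q_def[abs_def] eventually_conj_iff free_ultrafilter_eventually_not)
  qed
  have RF: "eventually (\<lambda>x. eventually (R x) G) F" if "free_ultrafilter F" "free_ultrafilter G" "\<not> arrow F G" for F G
  proof -
    have "eventually (R x) G \<longleftrightarrow> \<not> eventually (blue x) G" for x
      using that(2) free_ultrafilter_neq[OF that(2)]
      by (simp add: R_def[abs_def] eventually_conj_iff free_ultrafilter_eventually_not)
    then show ?thesis
      using that by (simp add: free_ultrafilter_eventually_not arrow_def)
  qed
  have self: "\<not> arrow F F" if "free_ultrafilter F" for F
    using that no_transitive_triangle free_ultrafilter_not_bot by blast
  have symR: "R x y \<Longrightarrow> R y x" for x y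
    using blue_sym by (auto simp: R_def)
  obtain s d where lim: "limitin T s p sequentially" "limitin T d p' sequentially"
    and Q: "\<And>n. Q (s n)" "\<And>n. Q (d n)"
    and R: "\<And>m n. m \<noteq> n \<Longrightarrow> R (s m) (s n)" "\<And>m n. m \<noteq> n \<Longrightarrow> R (d m) (d n)"
      "\<And>m n. R (s m) (d n)"
  proof (rule generic_convergent_sequences[where R = R and Q = Q, OF T(2) F(1,2) G(1,2)])
    show "eventually Q F" "eventually Q G"
      using QF F G by blast+
    show "eventually (\<lambda>x. eventually (R x) F) F" "eventually (\<lambda>x. eventually (R x) G) F"
      "eventually (\<lambda>x. eventually (R x) F) G" "eventually (\<lambda>x. eventually (R x) G) G"
      using RF self F(1) G(1) FG by blast+
  qed (use symR in blast)+
  define X where "X = insert p (range s \<union> range d)"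
  have hom: "subtopology T X homeomorphic_space ord_topology omega_times_2"
    unfolding X_def
  proof (rule two_convergent_sequences_homeomorphic[OF T(1) lim(1) _ _ _ _ lim(2) _ _ _ _ neq])
    show "inj s" "inj d" "range s \<inter> range d = {}"
      using R by (auto simp: R_def inj_def)
  qed (use Q in \<open>auto simp: Q_def\<close>)
  have sub: "X \<subseteq> topspace T"
    using Q limitin_topspace[OF lim(1)] by (auto simp: X_def Q_def)
  have red: "\<not> blue x y" if xy: "x \<in> X" "y \<in> X" "x \<noteq> y" for x y
  proof -
    have p: "\<not> blue p z \<and> \<not> blue z p" if "z \<in> X" "z \<noteq> p" for z
      using that Q blue_sym[of z p] by (auto simp: X_def Q_def)
    have "R x y" if not_p: "x \<noteq> p" "y \<noteq> p"
    proof -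
      consider m n where "x = s m" "y = s n" | m n where "x = s m" "y = d n"
        | m n where "x = d m" "y = s n" | m n where "x = d m" "y = d n"
        using xy not_p by (auto simp: X_def)
      then show ?thesis
      proof cases
        case (1 m n)
        then show ?thesis using R(1)[of m n] xy(3) by auto
      next
        case (2 m n)
        then show ?thesis using R(3) by simp
      next
        case (3 m n)
        then show ?thesis using symR[OF R(3)] by simp
      next
        case (4 m n)
        then show ?thesis using R(2)[of m n] xy(3) by auto
      qed
    qed
    then show ?thesis
      using p xy by (cases "x = p \<or> y = p") (auto simp: R_def)
  qed
  show ?thesis
    using sub hom red by blast
qed

end

text \<open>
  The combinatorial content of the absence of red copies: the assumption is the contrapositive of
  \<open>red_copy_of_omega_times_2\<close>.
\<close>

locale no_red_omega_times_2 = triangle_free blue for blue :: "'a \<Rightarrow> 'a \<Rightarrow> bool" +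
  fixes T :: "'a topology"
  assumes adjacent_filters: "\<And>F G p p'. \<lbrakk>free_ultrafilter F; limitin T (\<lambda>x. x) p F; \<not> eventually (blue p) F;
    free_ultrafilter G; limitin T (\<lambda>x. x) p' G; \<not> eventually (blue p) G; p \<noteq> p'\<rbrakk> \<Longrightarrow> arrow F G \<or> arrow G F"
begin

text \<open>
  By Ramsey's theorem it is uniform for \<open>i < j\<close> whether \<open>p i\<close> is near \<open>X j\<close>, whether \<open>p j\<close> is near
  \<open>X i\<close>, and whether there is an arrow from \<open>X i\<close> to \<open>X j\<close>. If \<open>p i\<close> is not near \<open>X j\<close>, then the
  point \<open>p i\<close> and the filters \<open>X i\<close> and \<open>X j\<close> force an arrow between \<open>X i\<close> and \<open>X j\<close>. Nearness in neither
  direction thus gives a transitive triangle of arrows among three filters. Nearness in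
  exactly one direction gives a point that is near two of three filters, which forbids an arrow between
  these, while the third point requires one.
\<close>

lemma cross_adjacency:
  fixes p :: "nat \<Rightarrow> 'a" and X :: "nat \<Rightarrow> 'a filter"
  assumes p: "inj p" and X: "\<And>i. free_ultrafilter (X i)" "\<And>i. limitin T (\<lambda>x. x) (p i) (X i)"
    and I: "infinite I" "\<And>i. i \<in> I \<Longrightarrow> \<not> eventually (blue (p i)) (X i)"
  shows "\<exists>J \<subseteq> I. infinite J \<and> (\<forall>i\<in>J. \<forall>j\<in>J. i \<noteq> j \<longrightarrow> eventually (blue (p i)) (X j))"
proof -
  have bot: "X i \<noteq> bot" for i
    using X(1) by (rule free_ultrafilter_not_bot)
  define near where "near i j \<longleftrightarrow> eventually (blue (p i)) (X j)" for i j
  have adj: "arrow (X i) (X j) \<or> arrow (X j) (X i)"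
    if "i \<in> I" "i \<noteq> j" "\<not> near i j" for i j
    using that I(2) p X by (intro adjacent_filters[where p = "p i" and p' = "p j"]) (auto simp: near_def inj_eq)
  have near: "\<not> arrow (X j) (X k)" if "near i j" "near i k" for i j k
    using that no_arrow_in_neighbourhood[OF bot bot] by (auto simp: near_def)
  obtain J where J: "J \<subseteq> I" "infinite J"
    "(\<forall>i\<in>J. \<forall>j\<in>J. i < j \<longrightarrow> near i j) \<or> (\<forall>i\<in>J. \<forall>j\<in>J. i < j \<longrightarrow> \<not> near i j)"
    using Ramsey_ordered_pairs[OF I(1), of near] by blast
  obtain K where K: "K \<subseteq> J" "infinite K"
    "(\<forall>i\<in>K. \<forall>j\<in>K. i < j \<longrightarrow> near j i) \<or> (\<forall>i\<in>K. \<forall>j\<in>K. i < j \<longrightarrow> \<not> near j i)"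
    using Ramsey_ordered_pairs[OF J(2), of "\<lambda>i j. near j i"] by blast
  obtain L where L: "L \<subseteq> K" "infinite L"
    "(\<forall>i\<in>L. \<forall>j\<in>L. i < j \<longrightarrow> arrow (X i) (X j)) \<or> (\<forall>i\<in>L. \<forall>j\<in>L. i < j \<longrightarrow> \<not> arrow (X i) (X j))"
    using Ramsey_ordered_pairs[OF K(2), of "\<lambda>i j. arrow (X i) (X j)"] by blast
  obtain i j k where ijk: "i \<in> L" "j \<in> L" "k \<in> L" "i < j" "j < k"
    using L(2) by (rule infinite_nat_three_elements)
  have mem: "i \<in> K" "j \<in> K" "k \<in> K" "i \<in> J" "j \<in> J" "k \<in> J" "i \<in> I" "j \<in> I" "k \<in> I"
    using ijk L(1) K(1) J(1) by blast+
  have up: "near i j \<and> near i k \<and> near j k"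
  proof (rule ccontr)
    assume "\<not> (near i j \<and> near i k \<and> near j k)"
    then have n: "\<not> near i j" "\<not> near i k" "\<not> near j k"
      using J(3) mem ijk by (meson less_trans)+
    show False
    proof (cases "near k i \<and> near k j")
      case True
      then show False
        using adj[of i j] n(1) near ijk mem by blast
    next
      case False
      have "arrow (X i) (X j) \<or> arrow (X j) (X i)" "arrow (X i) (X k) \<or> arrow (X k) (X i)"
        "arrow (X j) (X k) \<or> arrow (X k) (X j)"
        using adj[of i j] adj[of i k] adj[of j k] n mem ijk by auto
      then have "arrow (X i) (X j) \<and> arrow (X i) (X k) \<and> arrow (X j) (X k) \<or>
          arrow (X k) (X j) \<and> arrow (X k) (X i) \<and> arrow (X j) (X i)"
        using L(3) ijk by (meson less_trans)
      then show False
        using no_transitive_triangle[OF bot bot bot] by blast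
    qed
  qed
  have down: "near j i \<and> near k j"
  proof (rule ccontr)
    assume "\<not> (near j i \<and> near k j)"
    then have "\<not> near k j"
      using K(3) mem ijk by meson
    then have "arrow (X k) (X j) \<or> arrow (X j) (X k)"
      using mem ijk by (intro adj) auto
    then show False
      using near up by blast
  qed
  have "near a b" if "a \<in> K" "b \<in> K" "a \<noteq> b" for a b
  proof (cases "a < b")
    case True
    then show ?thesis
      using J(3) that K(1) up mem ijk by blast
  next
    case False
    then show ?thesis
      using K(3) that down mem ijk by (meson linorder_neqE_nat)
  qed
  then show ?thesis
    using K(1,2) J(1) unfolding near_def by (meson subset_trans)
qed

text \<open>
  The two key facts are \<open>UV\<close> and \<open>cross_adjacency\<close>. Suppose that infinitely many \<open>p i\<close> are near \<open>U i\<close>.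
  They are not near \<open>V i\<close> by \<open>UV\<close>, so infinitely many of them are near each other's \<open>V j\<close>, hence not near
  \<open>U j\<close>. As \<open>p i\<close> is near neither \<open>V i\<close> nor \<open>U j\<close>, there is an arrow between these; but \<open>p j\<close> is near
  both. Otherwise infinitely many \<open>p i\<close> are near each other's \<open>U j\<close>, hence not near
  \<open>V j\<close>. If such a \<open>p i\<close> is near \<open>V i\<close>, then there is no arrow between \<open>V i\<close> and \<open>U j\<close>, although
  \<open>p j\<close> is near neither. So none is, and by \<open>cross_adjacency\<close> infinitely many are near each other's
  \<open>V j\<close>, which was excluded.
\<close>

lemma no_rank_two_points:
  fixes p :: "nat \<Rightarrow> 'a" and q :: "nat \<Rightarrow> nat \<Rightarrow> 'a" and w :: "nat \<Rightarrow> nat \<Rightarrow> nat \<Rightarrow> 'a"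
  assumes p: "inj p" and q: "\<And>i. inj (q i)" "\<And>i. limitin T (q i) (p i) sequentially"
    and w: "\<And>i j. inj (w i j)" "\<And>i j. limitin T (w i j) (q i j) sequentially"
  shows False
proof -
  obtain \<U> :: "nat filter" where \<U>: "free_ultrafilter \<U>"
    using exists_free_ultrafilter_nat by blast
  have lim: "limitin T (\<lambda>x. x) a (filtermap f \<U>)" if "limitin T f a sequentially" for f a
    using that filter_leD[OF free_ultrafilter_le_sequentially[OF \<U>]]
    by (auto simp: limitin_def eventually_filtermap)
  define U where "U i = filtermap (q i) \<U>" for i
  define W where "W i j = filtermap (w i j) \<U>" for i j
  define V where "V i = iterated_limit \<U> (W i)" for i
  have free: "free_ultrafilter (U i)" "free_ultrafilter (W i j)" "free_ultrafilter (V i)" for i j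
    unfolding U_def V_def W_def using \<U> q(1) w(1)
    by (auto intro!: free_ultrafilter_filtermap free_ultrafilter_iterated_limit)
  note bot = free[THEN free_ultrafilter_not_bot]
  have limU: "limitin T (\<lambda>x. x) (p i) (U i)" and limW: "limitin T (\<lambda>x. x) (q i j) (W i j)" for i j
    unfolding U_def W_def using q(2) w(2) by (auto intro!: lim)
  have limV: "limitin T (\<lambda>x. x) (p i) (V i)" for i
    unfolding limitin_def
  proof (intro conjI allI impI)
    show "p i \<in> topspace T"
      using limU by (rule limitin_topspace)
    fix O' assume O': "openin T O' \<and> p i \<in> O'"
    then have "eventually (\<lambda>x. x \<in> O') (U i)"
      using limU by (auto simp: limitin_def)
    then have "eventually (\<lambda>j. q i j \<in> O') \<U>"
      by (simp add: U_def eventually_filtermap)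
    then have "eventually (\<lambda>j. eventually (\<lambda>x. x \<in> O') (W i j)) \<U>"
      by (rule eventually_mono) (use O' limW in \<open>auto simp: limitin_def\<close>)
    then show "eventually (\<lambda>x. x \<in> O') (V i)"
      by (simp add: V_def eventually_iterated_limit)
  qed
  \<comment> \<open>For a neighbour \<open>q i j\<close> of \<open>x\<close>, being near \<open>W i j\<close> or \<open>U i\<close> gives a triangle; otherwise
    \<open>q i j\<close>, \<open>W i j\<close> and \<open>U i\<close> force an arrow between two filters that \<open>x\<close> is near.\<close>
  have UV: "\<not> eventually (blue x) (V i)" if U: "eventually (blue x) (U i)" for x i
  proof
    assume "eventually (blue x) (V i)"
    then have "eventually (\<lambda>j. eventually (blue x) (W i j)) \<U>"
      by (simp add: V_def eventually_iterated_limit)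
    moreover have "eventually (\<lambda>j. blue x (q i j)) \<U>" "eventually (\<lambda>j. q i j \<noteq> p i) \<U>"
      using U free_ultrafilter_neq(1)[OF free(1), of "p i" i] by (auto simp: U_def eventually_filtermap)
    ultimately have "eventually (\<lambda>j. eventually (blue x) (W i j) \<and> blue x (q i j) \<and> q i j \<noteq> p i) \<U>"
      by (simp add: eventually_conj_iff)
    then obtain j where j: "eventually (blue x) (W i j)" "blue x (q i j)" "q i j \<noteq> p i"
      using eventually_happens' free_ultrafilter_not_bot[OF \<U>] by blast
    have "\<not> eventually (blue (q i j)) (W i j)" "\<not> eventually (blue (q i j)) (U i)"
      using adjacent_not_both_near[OF _ j(2)] j(1) U bot by blast+
    then have "arrow (W i j) (U i) \<or> arrow (U i) (W i j)"
      using free limU limW j(3) by (intro adjacent_filters) auto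
    then show False
      using no_arrow_in_neighbourhood bot j(1) U by blast
  qed
  define I where "I = {i. eventually (blue (p i)) (U i)}"
  consider "infinite I" | "infinite (- I)"
    by (metis finite_UnI Compl_partition infinite_UNIV_nat)
  then show False
  proof cases
    case 1
    have "\<not> eventually (blue (p i)) (V i)" if "i \<in> I" for i
      using that UV by (auto simp: I_def)
    then obtain J where J: "J \<subseteq> I" "infinite J" "\<forall>i\<in>J. \<forall>j\<in>J. i \<noteq> j \<longrightarrow> eventually (blue (p i)) (V j)"
      using cross_adjacency[OF p free(3) limV 1] by blast
    obtain i j where ij: "i \<in> J" "j \<in> J" "i < j"
      using J(2) infinite_nat_three_elements by metis
    have "\<not> eventually (blue (p i)) (U j)"
      using UV[of "p i" j] J(3) ij by auto
    moreover have "\<not> eventually (blue (p i)) (V i)"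
      using UV ij J(1) by (auto simp: I_def)
    ultimately have "arrow (V i) (U j) \<or> arrow (U j) (V i)"
      using free limU limV ij p
      by (intro adjacent_filters[where p = "p i" and p' = "p j"]) (auto simp: inj_eq)
    moreover have "eventually (blue (p j)) (U j)" "eventually (blue (p j)) (V i)"
      using J(1,3) ij by (auto simp: I_def)
    ultimately show False
      using no_arrow_in_neighbourhood bot by blast
  next
    case 2
    have "\<not> eventually (blue (p i)) (U i)" if "i \<in> - I" for i
      using that by (auto simp: I_def)
    then obtain J where J: "J \<subseteq> - I" "infinite J" "\<forall>i\<in>J. \<forall>j\<in>J. i \<noteq> j \<longrightarrow> eventually (blue (p i)) (U j)"
      using cross_adjacency[OF p free(1) limU 2] by blast
    have notV: "\<not> eventually (blue (p i)) (V j)" if "i \<in> J" "j \<in> J" "i \<noteq> j" for i j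
      using UV J(3) that by blast
    have notV_self: "\<not> eventually (blue (p i)) (V i)" if i: "i \<in> J" for i
    proof
      assume V: "eventually (blue (p i)) (V i)"
      obtain j where j: "j \<in> J" "j \<noteq> i"
        using J(2) by (metis finite.emptyI finite_insert finite_subset insertI1 subsetI)
      have "arrow (U j) (V i) \<or> arrow (V i) (U j)"
        using free limU limV p notV[of j i] J(1) i j
        by (intro adjacent_filters[where p = "p j" and p' = "p i"]) (auto simp: I_def inj_eq)
      moreover have "eventually (blue (p i)) (U j)"
        using J(3) i j by auto
      ultimately show False
        using no_arrow_in_neighbourhood bot V by blast
    qed
    obtain K where K: "K \<subseteq> J" "infinite K" "\<forall>i\<in>K. \<forall>j\<in>K. i \<noteq> j \<longrightarrow> eventually (blue (p i)) (V j)"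
      using cross_adjacency[OF p free(3) limV J(2) notV_self] by blast
    obtain i j where ij: "i \<in> K" "j \<in> K" "i < j"
      using K(2) infinite_nat_three_elements by metis
    then have "\<not> eventually (blue (p i)) (V j)"
      using K(1) by (intro notV) auto
    then show False
      using K(3) ij by auto
  qed
qed

end

section \<open>The upper bound\<close>

lemma doubleton_in_nsets_2: "x \<in> X \<Longrightarrow> y \<in> X \<Longrightarrow> x \<noteq> y \<Longrightarrow> {x, y} \<in> nsets X 2"
  by (simp add: nsets_def)

lemma ball_nsets_2: "(\<forall>e \<in> nsets X 2. P e) \<longleftrightarrow> (\<forall>x\<in>X. \<forall>y\<in>X. x \<noteq> y \<longrightarrow> P {x, y})"
proof
  assume P: "\<forall>e \<in> nsets X 2. P e"
  show "\<forall>x\<in>X. \<forall>y\<in>X. x \<noteq> y \<longrightarrow> P {x, y}"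
    by (intro ballI impI P[rule_format] doubleton_in_nsets_2)
next
  assume P: "\<forall>x\<in>X. \<forall>y\<in>X. x \<noteq> y \<longrightarrow> P {x, y}"
  show "\<forall>e \<in> nsets X 2. P e"
  proof
    fix e assume "e \<in> nsets X 2"
    then obtain x y where "e = {x, y}" "x \<noteq> y" "e \<subseteq> X"
      by (auto simp: nsets_def card_2_iff)
    then show "P e"
      using P by auto
  qed
qed

text \<open>
  The upper bound in general form: it applies to every first countable Hausdorff space with infinitely
  many points of Cantor-Bendixson rank at least two.
\<close>

lemma rank_two_points_partition:
  fixes T :: "'a topology" and c :: "'a set \<Rightarrow> colour"
    and p :: "nat \<Rightarrow> 'a" and q :: "nat \<Rightarrow> nat \<Rightarrow> 'a" and w :: "nat \<Rightarrow> nat \<Rightarrow> nat \<Rightarrow> 'a"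
  assumes T: "Hausdorff_space T" "first_countable T"
    and p: "inj p" and q: "\<And>i. inj (q i)" "\<And>i. limitin T (q i) (p i) sequentially"
    and w: "\<And>i j. inj (w i j)" "\<And>i j. limitin T (w i j) (q i j) sequentially"
  shows "(\<exists>X \<subseteq> topspace T. subtopology T X homeomorphic_space ord_topology omega_times_2 \<and>
             (\<forall>e \<in> nsets X 2. c e = Red)) \<or>
         (\<exists>Y \<in> nsets (topspace T) 3. \<forall>e \<in> nsets Y 2. c e = Blue)"
proof (rule ccontr)
  assume contra: "\<not> ?thesis"
  define blue where "blue x y \<longleftrightarrow> x \<in> topspace T \<and> y \<in> topspace T \<and> x \<noteq> y \<and> c {x, y} = Blue" for x y
  interpret triangle_free blue
  proof
    show "blue y x" if "blue x y" for x y
      using that by (auto simp: blue_def insert_commute)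
    show False if "blue x y" "blue x z" "blue y z" for x y z
    proof -
      have "{x, y, z} \<in> nsets (topspace T) 3"
        using that by (auto simp: blue_def nsets_def)
      moreover have "\<forall>e \<in> nsets {x, y, z} 2. c e = Blue"
        unfolding ball_nsets_2 using that by (auto simp: blue_def insert_commute)
      ultimately show False
        using contra by blast
    qed
  qed
  interpret no_red_omega_times_2 blue T
  proof
    fix F G p p'
    assume F: "free_ultrafilter F" "limitin T (\<lambda>x. x) p F" "\<not> eventually (blue p) F"
      and G: "free_ultrafilter G" "limitin T (\<lambda>x. x) p' G" "\<not> eventually (blue p) G" and "p \<noteq> p'"
    show "arrow F G \<or> arrow G F"
    proof (rule ccontr)
      assume "\<not> (arrow F G \<or> arrow G F)"
      then have FG: "\<not> arrow F G" "\<not> arrow G F"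
        by auto
      obtain X where X: "X \<subseteq> topspace T"
          "subtopology T X homeomorphic_space ord_topology omega_times_2"
          "\<forall>x\<in>X. \<forall>y\<in>X. x \<noteq> y \<longrightarrow> \<not> blue x y"
        using red_copy_of_omega_times_2[OF T F G \<open>p \<noteq> p'\<close> FG] by blast
      have "c {x, y} = Red" if "x \<in> X" "y \<in> X" "x \<noteq> y" for x y
        using X(1,3) that by (cases "c {x, y}") (auto simp: blue_def)
      then have "\<forall>e \<in> nsets X 2. c e = Red"
        by (simp add: ball_nsets_2)
      then show False
        using contra X(1,2) by blast
    qed
  qed
  show False
    by (rule no_rank_two_points[OF p q w])
qed

abbreviation omega_cubed_times :: "nat \<Rightarrow> (((nat \<times> nat) \<times> nat) \<times> nat) rel" where
  "omega_cubed_times n \<equiv> ((natLeq \<cdot>\<^sub>o natLeq) \<cdot>\<^sub>o natLeq) \<cdot>\<^sub>o natLeq_on n"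

lemma Well_order_omega_cubed_times: "Well_order (omega_cubed_times n)"
  by (intro Well_order_ord_prod natLeq_Well_order natLeq_on_Well_order)

text \<open>
  The triple \<open>((k, j), i)\<close> in the first copy of \<open>\<omega>\<^sup>3\<close> is the ordinal \<open>\<omega>\<^sup>2 \<cdot> i + \<omega> \<cdot> j + k\<close>. The points of
  rank two are the nonzero multiples of \<open>\<omega>\<^sup>2\<close>.
\<close>

lemma top_arrow_omega_cubed_times:
  assumes "n > 0"
  shows "top_arrow (omega_cubed_times n) omega_times_2 3"
proof -
  let ?r = "omega_cubed_times n"
  let ?T = "ord_topology ?r"
  note wo = Well_order_omega_cubed_times[of n]
  have T: "Hausdorff_space ?T" "first_countable ?T"
    using wo by (auto intro: Hausdorff_ord_topology first_countable_ord_topology)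
  define p :: "nat \<Rightarrow> ((nat \<times> nat) \<times> nat) \<times> nat" where "p i = (((0, 0), Suc i), 0)" for i
  define q :: "nat \<Rightarrow> nat \<Rightarrow> ((nat \<times> nat) \<times> nat) \<times> nat" where "q i j = (((0, Suc j), i), 0)" for i j
  define w :: "nat \<Rightarrow> nat \<Rightarrow> nat \<Rightarrow> ((nat \<times> nat) \<times> nat) \<times> nat" where "w i j k = (((k, j), i), 0)" for i j k
  have inj: "inj p" "inj (q i)" "inj (w i j)" for i j
    by (auto simp: inj_def p_def q_def w_def)
  have q: "limitin ?T (q i) (p i) sequentially" for i
  proof (rule limitin_ord_topology[OF wo])
    fix b assume b: "b \<in> underS ?r (p i)"
    obtain x y z t where [simp]: "b = (((x, y), z), t)"
      by (metis prod.exhaust)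
    have "q i j \<in> aboveS ?r b" if "j > y" for j
      using b that by (auto simp: underS_def aboveS_def p_def q_def mem_ord_prod)
    then show "eventually (\<lambda>j. q i j \<in> aboveS ?r b) sequentially"
      using eventually_gt_at_top[of y] by (rule eventually_mono[rotated])
  qed (use assms in \<open>auto simp: p_def q_def mem_ord_prod\<close>)
  have w: "limitin ?T (w i j) (q i j) sequentially" for i j
  proof (rule limitin_ord_topology[OF wo])
    fix b assume b: "b \<in> underS ?r (q i j)"
    obtain x y z t where [simp]: "b = (((x, y), z), t)"
      by (metis prod.exhaust)
    have "w i j k \<in> aboveS ?r b" if "k > x" for k
      using b that by (auto simp: underS_def aboveS_def w_def q_def mem_ord_prod)
    then show "eventually (\<lambda>k. w i j k \<in> aboveS ?r b) sequentially"
      using eventually_gt_at_top[of x] by (rule eventually_mono[rotated])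
  qed (use assms in \<open>auto simp: w_def q_def mem_ord_prod\<close>)
  show ?thesis
    unfolding top_arrow_def
    using rank_two_points_partition[OF T inj(1,2) q inj(3) w]
    unfolding topspace_ord_topology by (intro allI)
qed

section \<open>The lower bound\<close>

abbreviation omega_squared_times_3 :: "((nat \<times> nat) \<times> nat) rel" where
  "omega_squared_times_3 \<equiv> (natLeq \<cdot>\<^sub>o natLeq) \<cdot>\<^sub>o natLeq_on 3"

lemma Well_order_omega_squared_times_3: "Well_order omega_squared_times_3"
  by (intro Well_order_ord_prod natLeq_Well_order natLeq_on_Well_order)

text \<open>
  The ordinal \<open>\<omega>\<^sup>2 \<cdot> i + \<omega> \<cdot> j + k\<close> is a successor if \<open>k > 0\<close>. The first line joins it to the next
  limit \<open>\<omega>\<^sup>2 \<cdot> i + \<omega> \<cdot> (j + 1)\<close> and to the multiples of \<open>\<omega>\<^sup>2\<close>, the second joins limits in the first copy of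
  \<open>\<omega>\<^sup>2\<close> to limits in the second. Here \<open>0\<close> is treated as a multiple of \<open>\<omega>\<^sup>2\<close>, which is harmless
  since it is isolated.
\<close>

fun blue_arc :: "(nat \<times> nat) \<times> nat \<Rightarrow> (nat \<times> nat) \<times> nat \<Rightarrow> bool" where
  "blue_arc ((k, j), i) ((k', j'), i') \<longleftrightarrow>
     k > 0 \<and> k' = 0 \<and> (j' = 0 \<or> j' = Suc j \<and> i' = i) \<or>
     k = 0 \<and> k' = 0 \<and> j > 0 \<and> j' > 0 \<and> i = 0 \<and> i' = 1"

definition blue_adj :: "(nat \<times> nat) \<times> nat \<Rightarrow> (nat \<times> nat) \<times> nat \<Rightarrow> bool" where
  "blue_adj x y \<longleftrightarrow> blue_arc x y \<or> blue_arc y x"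

lemma blue_adj_no_triangle: "blue_adj x y \<Longrightarrow> blue_adj y z \<Longrightarrow> \<not> blue_adj x z"
proof -
  obtain k1 j1 i1 k2 j2 i2 k3 j3 i3 where "x = ((k1, j1), i1)" "y = ((k2, j2), i2)" "z = ((k3, j3), i3)"
    by (metis prod.exhaust)
  then show "blue_adj x y \<Longrightarrow> blue_adj y z \<Longrightarrow> \<not> blue_adj x z"
    by (simp add: blue_adj_def) linarith
qed

lemma blue_adj_rank_zero: "k > 0 \<Longrightarrow> blue_adj ((k, j), i) ((0, 0), i')"
  by (simp add: blue_adj_def)

text \<open>
  The limit point \<open>p\<close> of a red copy \<open>X\<close> is not isolated, and not of rank one because the points next to it would
  be adjacent to it. So \<open>p = \<omega>\<^sup>2 \<cdot> Suc i'\<close>, and \<open>X\<close> contains no successors. As \<open>p\<close> is a limit,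
  \<open>X\<close> contains a limit ordinal in the copy \<open>i'\<close> of \<open>\<omega>\<^sup>2\<close>. The infinitely many points of \<open>X\<close> outside a
  neighbourhood of \<open>p\<close> cannot all be in the copy \<open>i'\<close>, nor in the last copy, of which \<open>A\<close>
  contains only finitely many limits. So one of them is a limit in the other one of the first two
  copies, and these two points are adjacent.
\<close>

lemma not_top_arrow_below_omega_squared_times_3:
  assumes a: "a \<in> Field omega_squared_times_3"
  defines "A \<equiv> underS omega_squared_times_3 a"
  shows "\<not> top_arrow (Restr omega_squared_times_3 A) omega_times_2 3"
proof
  let ?r = "omega_squared_times_3"
  define \<delta> where "\<delta> = Restr ?r A"
  define T where "T = ord_topology \<delta>"
  assume "top_arrow (Restr omega_squared_times_3 A) omega_times_2 3"
  then have arrow: "top_arrow \<delta> omega_times_2 3"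
    by (simp add: \<delta>_def)
  note wo_r = Well_order_omega_squared_times_3
  have wo: "Well_order \<delta>"
    unfolding \<delta>_def using wo_r by (rule Well_order_Restr)
  have A_field: "A \<subseteq> Field ?r"
    by (auto simp: A_def underS_def Field_def)
  have mem_r: "(((k, j), i), ((k', j'), i')) \<in> ?r \<longleftrightarrow>
      i < 3 \<and> i' < 3 \<and> (i < i' \<or> i = i' \<and> (j < j' \<or> j = j' \<and> k \<le> k'))" for k j i k' j' i'
    by (auto simp: mem_ord_prod)
  have mem: "(x, y) \<in> \<delta> \<longleftrightarrow> x \<in> A \<and> y \<in> A \<and> (x, y) \<in> ?r" for x y
    by (auto simp: \<delta>_def)
  have field: "Field \<delta> = A"
  proof
    show "Field \<delta> \<subseteq> A"
      by (auto simp: \<delta>_def Field_def)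
    show "A \<subseteq> Field \<delta>"
    proof
      fix x assume "x \<in> A"
      then have "(x, x) \<in> \<delta>"
        using mem[of x x] Well_order_facts(1)[OF wo_r] A_field by blast
      then show "x \<in> Field \<delta>"
        by (rule FieldI1)
    qed
  qed
  have down: "x \<in> A" if "y \<in> A" "(x, y) \<in> ?r" for x y
    using that Well_order_facts(2,3)[OF wo_r] unfolding A_def underS_def by blast
  have lt3: "i < 3" if "((k, j), i) \<in> A" for k j i
    using that A_field by (auto simp: mem_ord_prod)
  have top_row: "finite {x \<in> A. \<exists>j. x = ((0, j), 2)}"
  proof -
    obtain x y z where "a = ((x, y), z)"
      by (metis prod.exhaust)
    then have "{x \<in> A. \<exists>j. x = ((0, j), 2)} \<subseteq> (\<lambda>j. ((0, j), 2)) ` {..y}"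
      by (auto simp: A_def underS_def mem_r)
    then show ?thesis
      by (rule finite_subset) simp
  qed
  have interval: "openin T {x \<in> A. (x, p) \<in> ?r \<and> (b, x) \<in> ?r \<and> x \<noteq> b}" if "p \<in> A" "(b, p) \<in> ?r" for p b
  proof -
    have "{x \<in> A. (x, p) \<in> ?r \<and> (b, x) \<in> ?r \<and> x \<noteq> b} = {x. (x, p) \<in> \<delta> \<and> (b, x) \<in> \<delta> \<and> x \<noteq> b}"
      using that down by (auto simp: mem)
    then show ?thesis
      unfolding T_def using openin_ord_topology_interval[OF wo] that down field by simp
  qed
  define c where "c e = (if \<exists>x y. e = {x, y} \<and> blue_adj x y then Blue else Red)" for e
  have c: "c {x, y} = Blue \<longleftrightarrow> blue_adj x y" for x y
  proof -
    have "blue_adj x y" if "{x, y} = {x', y'}" "blue_adj x' y'" for x' y'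
      using that by (auto simp: doubleton_eq_iff blue_adj_def)
    then have "(\<exists>x' y'. {x, y} = {x', y'} \<and> blue_adj x' y') \<longleftrightarrow> blue_adj x y"
      by blast
    then show ?thesis
      unfolding c_def by simp
  qed
  have "\<not> (\<exists>Y \<in> nsets (Field \<delta>) 3. \<forall>e \<in> nsets Y 2. c e = Blue)"
  proof
    assume "\<exists>Y \<in> nsets (Field \<delta>) 3. \<forall>e \<in> nsets Y 2. c e = Blue"
    then obtain Y where Y: "Y \<in> nsets (Field \<delta>) 3" "\<forall>e \<in> nsets Y 2. c e = Blue"
      by blast
    have adj: "\<forall>x\<in>Y. \<forall>y\<in>Y. x \<noteq> y \<longrightarrow> blue_adj x y"
      using Y(2) unfolding ball_nsets_2 c .
    have "card Y = 3"
      using Y(1) by (simp add: nsets_def)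
    then obtain x y z where xyz: "Y = {x, y, z}" "x \<noteq> y" "y \<noteq> z" "x \<noteq> z"
      unfolding card_3_iff by blast
    then have "x \<in> Y" "y \<in> Y" "z \<in> Y"
      by blast+
    then show False
      using adj xyz blue_adj_no_triangle[of x y z] by blast
  qed
  then obtain X where X: "X \<subseteq> A" and hom: "subtopology T X homeomorphic_space ord_topology omega_times_2"
    and "\<forall>e \<in> nsets X 2. c e = Red"
    using arrow unfolding top_arrow_def field T_def by meson
  then have red: "\<not> blue_adj x y" if "x \<in> X" "y \<in> X" "x \<noteq> y" for x y
    using that c[of x y] unfolding ball_nsets_2 by auto
  have space: "topspace (subtopology T X) = X"
    using X field by (auto simp: T_def)
  obtain p N where "p \<in> topspace (subtopology T X)"
    and limit': "\<And>U. openin (subtopology T X) U \<Longrightarrow> p \<in> U \<Longrightarrow> \<exists>x\<in>U. x \<noteq> p"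
    and N: "openin (subtopology T X) N" "p \<in> N" "infinite (topspace (subtopology T X) - N)"
    using homeomorphic_omega_times_2_limit_point[OF hom] by blast
  then have p: "p \<in> X" "p \<in> A"
    using X space by auto
  have limit: "\<exists>x \<in> U \<inter> X. x \<noteq> p" if "openin T U" "p \<in> U" for U
    using that p by (intro limit') (auto intro: openin_subtopology_Int)
  have limit_above: "\<exists>x \<in> X. x \<noteq> p \<and> (x, p) \<in> ?r \<and> (b, x) \<in> ?r \<and> x \<noteq> b"
    if "(b, p) \<in> ?r" "b \<noteq> p" for b
    using limit[OF interval[OF p(2) that(1)]] that p(2) Well_order_facts(1)[OF wo_r, of p] A_field
    by blast
  obtain N' where N': "openin T N'" "N = N' \<inter> X"
    using N(1) by (auto simp: openin_subtopology)
  have inf: "infinite (X - N')"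
    using N(3) N'(2) space by (simp add: Diff_Int)
  obtain k j i where p_eq: "p = ((k, j), i)"
    by (metis prod.exhaust)
  have i3: "i < 3"
    using lt3 p(2) p_eq by blast
  have "k = 0"
  proof (rule ccontr)
    assume "k \<noteq> 0"
    have "(((k - 1, j), i), p) \<in> ?r" "((k - 1, j), i) \<noteq> p"
      using i3 \<open>k \<noteq> 0\<close> by (auto simp: p_eq mem_r)
    then obtain x where x: "x \<in> X" "x \<noteq> p" "(x, p) \<in> ?r" "(((k - 1, j), i), x) \<in> ?r" "x \<noteq> ((k - 1, j), i)"
      using limit_above by blast
    obtain k' j' i' where "x = ((k', j'), i')"
      by (metis prod.exhaust)
    then show False
      using x by (auto simp: p_eq mem_r)
  qed
  have "j = 0"
  proof (rule ccontr)
    assume "j \<noteq> 0"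
    have "(((0, j - 1), i), p) \<in> ?r" "((0, j - 1), i) \<noteq> p"
      using i3 \<open>j \<noteq> 0\<close> by (auto simp: p_eq mem_r)
    then obtain x where x: "x \<in> X" "x \<noteq> p" "(x, p) \<in> ?r" "(((0, j - 1), i), x) \<in> ?r" "x \<noteq> ((0, j - 1), i)"
      using limit_above by blast
    obtain k' j' i' where x_eq: "x = ((k', j'), i')"
      by (metis prod.exhaust)
    then have "i' = i" "j' = j - 1" "k' > 0"
      using x(2-5) \<open>k = 0\<close> \<open>j \<noteq> 0\<close> unfolding p_eq x_eq mem_r by auto
    then have "blue_adj x p"
      using \<open>k = 0\<close> \<open>j \<noteq> 0\<close> by (simp add: p_eq x_eq blue_adj_def)
    then show False
      using red x p by blast
  qed
  have no_rank_zero: "k' = 0" if "((k', j'), i') \<in> X" for k' j' i'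
    using red[OF that p(1)] blue_adj_rank_zero[of k' j' i' i] \<open>k = 0\<close> \<open>j = 0\<close> p_eq by auto
  have "i \<noteq> 0"
  proof
    assume "i = 0"
    have "openin T {x. (x, p) \<in> \<delta>}"
      unfolding T_def using wo p(2) field by (intro openin_ord_topology_atMost) auto
    moreover have "p \<in> {x. (x, p) \<in> \<delta>}"
      using Well_order_facts(1)[OF wo, of p] p(2) field by simp
    ultimately obtain x where "x \<in> {x. (x, p) \<in> \<delta>} \<inter> X" "x \<noteq> p"
      using limit by blast
    then have x: "x \<in> X" "x \<noteq> p" "(x, p) \<in> ?r"
      using mem[of x p] by blast+
    obtain k' j' i' where "x = ((k', j'), i')"
      by (metis prod.exhaust)
    then show False
      using x \<open>i = 0\<close> \<open>k = 0\<close> \<open>j = 0\<close> by (auto simp: p_eq mem_r)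
  qed
  then obtain i' where i': "i = Suc i'" "i' < 2"
    using i3 by (cases i) auto
  have p_eq': "p = ((0, 0), Suc i')"
    by (simp add: p_eq \<open>k = 0\<close> \<open>j = 0\<close> i')
  obtain j\<^sub>0 where j0: "((0, Suc j\<^sub>0), i') \<in> X"
  proof -
    have "(((0, 0), i'), p) \<in> ?r" "((0, 0), i') \<noteq> p"
      using i' by (auto simp: p_eq' mem_r)
    then obtain x where x: "x \<in> X" "x \<noteq> p" "(x, p) \<in> ?r" "(((0, 0), i'), x) \<in> ?r" "x \<noteq> ((0, 0), i')"
      using limit_above by blast
    obtain k1 j1 i1 where x_eq: "x = ((k1, j1), i1)"
      by (metis prod.exhaust)
    have "k1 = 0"
      using no_rank_zero x(1) x_eq by blast
    then have "i1 = i'" "j1 \<noteq> 0"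
      using x i' by (auto simp: x_eq p_eq' mem_r)
    then show ?thesis
      using x(1) x_eq \<open>k1 = 0\<close> that by (cases j1) auto
  qed
  define s :: "nat \<Rightarrow> (nat \<times> nat) \<times> nat" where "s n = ((0, Suc n), i')" for n
  have "limitin T s p sequentially"
    unfolding T_def
  proof (rule limitin_ord_topology[OF wo])
    show "p \<in> Field \<delta>"
      using p field by simp
    have s: "s n \<in> A" for n
      using p(2) i' by (rule_tac down) (auto simp: s_def p_eq' mem_r)
    then show "(s n, p) \<in> \<delta>" for n
      using p(2) i' by (auto simp: mem s_def p_eq' mem_r)
    fix b assume b: "b \<in> underS \<delta> p"
    obtain x y z where b_eq: "b = ((x, y), z)"
      by (metis prod.exhaust)
    have "s n \<in> aboveS \<delta> b" if "n > y" for n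
      using b that s[of n] i' by (auto simp: underS_def aboveS_def mem p_eq' b_eq s_def mem_r)
    then show "eventually (\<lambda>n. s n \<in> aboveS \<delta> b) sequentially"
      using eventually_gt_at_top[of y] by (rule eventually_mono[rotated])
  qed
  then have "finite {n. s n \<notin> N'}"
    using N N' by (intro finite_limitin_sequentially) auto
  \<comment> \<open>Besides the limits in the other one of the first two copies, only these points of \<open>X\<close> can be outside \<open>N'\<close>.\<close>
  then have fin: "finite (s ` {n. s n \<notin> N'} \<union> {x \<in> A. \<exists>j. x = ((0, j), 2)} \<union> {((0, 0), 0), ((0, 0), 1)})"
    using top_row by simp
  have "\<not> X - N' \<subseteq> s ` {n. s n \<notin> N'} \<union> {x \<in> A. \<exists>j. x = ((0, j), 2)} \<union> {((0, 0), 0), ((0, 0), 1)}"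
    using inf fin finite_subset by blast
  then obtain x where x: "x \<in> X" "x \<notin> N'" "x \<notin> s ` {n. s n \<notin> N'}" "\<not> (\<exists>j. x = ((0, j), 2))"
      "x \<noteq> ((0, 0), 0)" "x \<noteq> ((0, 0), 1)"
    using X by blast
  obtain k1 j1 i1 where x_eq: "x = ((k1, j1), i1)"
    by (metis prod.exhaust)
  have k1: "k1 = 0"
    using no_rank_zero x(1) x_eq by blast
  have i1: "i1 = 0 \<or> i1 = 1"
    using lt3[of k1 j1 i1] x(1,4) X k1 by (auto simp: x_eq numeral_3_eq_3 numeral_2_eq_2 less_Suc_eq)
  then have j1: "j1 \<noteq> 0"
    using x k1 by (auto simp: x_eq)
  have "i1 \<noteq> i'"
  proof
    assume "i1 = i'"
    then have "x = s (j1 - 1)"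
      using j1 k1 by (simp add: s_def x_eq)
    then show False
      using x(2,3) by blast
  qed
  then have "blue_adj x ((0, Suc j\<^sub>0), i')"
    using i1 i'(2) j1 k1 by (auto simp: x_eq blue_adj_def)
  then show False
    using red[OF x(1) j0] x_eq \<open>i1 \<noteq> i'\<close> by auto
qed

section \<open>The Ramsey number\<close>

text \<open>
  The set \<open>\<Gamma>\<close> is nonempty because \<open>\<omega>\<^sup>3 \<cdot> 100\<close> is countable and so has a representative on the natural
  numbers. An ordinal below \<open>\<omega>\<^sup>2 \<cdot> 3\<close> is represented by a proper initial segment, to which the
  lower bound applies.
\<close>

theorem theorem8p1:
  shows "\<exists>\<beta> :: nat rel. is_top_ramsey \<beta> (natLeq \<cdot>\<^sub>o natLeq_on 2) 3 \<and>
           (natLeq \<cdot>\<^sub>o natLeq) \<cdot>\<^sub>o natLeq_on 3 \<le>o \<beta> \<and>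
           \<beta> \<le>o ((natLeq \<cdot>\<^sub>o natLeq) \<cdot>\<^sub>o natLeq) \<cdot>\<^sub>o natLeq_on 100"
proof -
  define \<Gamma> :: "nat rel set" where "\<Gamma> = {\<gamma>. Well_order \<gamma> \<and> top_arrow \<gamma> omega_times_2 3}"
  have upper: "top_arrow (omega_cubed_times 100) omega_times_2 3"
    by (rule top_arrow_omega_cubed_times) simp
  have iso: "(omega_cubed_times 100, dir_image (omega_cubed_times 100) to_nat) \<in> ordIso"
    by (intro dir_image_ordIso Well_order_omega_cubed_times) simp
  then have "dir_image (omega_cubed_times 100) to_nat \<in> \<Gamma>"
    using top_arrow_ordIso[OF iso upper] by (auto simp: \<Gamma>_def ordIso_def)
  then have "\<Gamma> \<noteq> {}"
    by blast
  then have "\<exists>\<beta>\<in>\<Gamma>. \<forall>\<gamma>\<in>\<Gamma>. \<beta> \<le>o \<gamma>"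
    by (rule exists_minim_Well_order) (simp add: \<Gamma>_def)
  then obtain \<beta> where \<beta>: "\<beta> \<in> \<Gamma>" "\<forall>\<gamma>\<in>\<Gamma>. \<beta> \<le>o \<gamma>"
    by blast
  have ramsey: "is_top_ramsey \<beta> omega_times_2 3"
    using \<beta> by (auto simp: is_top_ramsey_def \<Gamma>_def)
  have wo: "Well_order \<beta>"
    using \<beta>(1) by (simp add: \<Gamma>_def)
  have "omega_squared_times_3 \<le>o \<beta>"
  proof (rule ccontr)
    assume "\<not> omega_squared_times_3 \<le>o \<beta>"
    then have "\<beta> <o omega_squared_times_3"
      using wo Well_order_omega_squared_times_3 by (simp add: not_ordLeq_iff_ordLess)
    then obtain a where a: "a \<in> Field omega_squared_times_3"
        "(\<beta>, Restr omega_squared_times_3 (underS omega_squared_times_3 a)) \<in> ordIso"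
      using ordLess_iff_ordIso_Restr[OF Well_order_omega_squared_times_3 wo] by blast
    have "top_arrow \<beta> omega_times_2 3"
      using \<beta>(1) by (simp add: \<Gamma>_def)
    then have "top_arrow (Restr omega_squared_times_3 (underS omega_squared_times_3 a)) omega_times_2 3"
      by (rule top_arrow_ordIso[OF a(2)])
    then show False
      using not_top_arrow_below_omega_squared_times_3[OF a(1)] by blast
  qed
  moreover have "\<beta> \<le>o omega_cubed_times 100"
    using ramsey Well_order_omega_cubed_times upper by (rule is_top_ramsey_least)
  ultimately show ?thesis
    using ramsey by blast
qed

end
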